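(* Let $X$ be a compact Hausdorff space, $\mathcal C=C(X)$ with the supremum norm, $\alpha\colon X\to X$ continuous, $\delta f=f\circ\alpha$, and $A$ a transfer operator for $(\mathcal C,\delta)$. Then for every $\varphi\in\mathcal C$, \[ \lambda(\varphi)=\max_{\mu\in M_\delta(\mathcal C)}\bigl(\tau(\mu)+\mu[\varphi]\bigr), \] in particular the maximum is attained.
   Context: A transfer operator for $(\mathcal C,\delta)$ is a positive linear operator $A\colon\mathcal C\to\mathcal C$ with $A((\delta f)g)=f\,Ag$ for all $f,g\in\mathcal C$. $A_\varphi f=A(e^\varphi f)$ and $\lambda(\varphi)=\lim_{n\to\infty}\frac1n\ln\|A_\varphi^n\mathbf 1\|$ ($\mathbf 1$ the constant function $1$). $M(\mathcal C)$ is the set of positive linear functionals $m$ on $\mathcal C$ with $m[\mathbf 1]=1$; $M_\delta(\mathcal C)$ those with additionally $\mu[\delta f]=\mu[f]$ for all $f$. A partition of unity is a finite set $D$ of nonnegative elements of $\mathcal C$ summing to $\mathbf 1$. For $\mu\in M_\delta(\mathcal C)$: $\tau_n(\mu,D)=\sup_{m\in M(\mathcal C)}\sum_{g\in D}\mu[g]\ln\frac{m[A^ng]}{\mu[g]}$, $\tau_n(\mu)=\inf_D\tau_n(\mu,D)$ over all partitions of unity, $\tau(\mu)=\inf_{n\in\mathbb N}\tau_n(\mu)/n$ (the $t$-entropy); summands with $\mu[g]=0$ are set to $0$, $\ln0=-\infty$, and if some $g\in D$ has $A^ng=0$ and $\mu[g]>0$ then $\tau(\mu)=-\infty$. *)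

theory Defs
  imports "HOL-Analysis.Analysis"
begin

definition CX :: "('a::topological_space \<Rightarrow> real) set" where
  "CX = {f. continuous_on UNIV f}"

definition supnorm :: "('a \<Rightarrow> real) \<Rightarrow> real" where
  "supnorm f = (SUP x. \<bar>f x\<bar>)"

definition eln :: "real \<Rightarrow> ereal" where
  "eln x = (if x > 0 then ereal (ln x) else -\<infinity>)"

definition delta :: "('a \<Rightarrow> 'a) \<Rightarrow> ('a \<Rightarrow> real) \<Rightarrow> ('a \<Rightarrow> real)" where
  "delta \<alpha> f = f \<circ> \<alpha>"

definition one_fun :: "'a \<Rightarrow> real" ("\<one>") where
  "one_fun = (\<lambda>x. 1)"

definition positive_linear_op ::
  "(('a::topological_space \<Rightarrow> real) \<Rightarrow> ('a \<Rightarrow> real)) \<Rightarrow> bool" where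
  "positive_linear_op A \<longleftrightarrow>
     (\<forall>f\<in>CX. A f \<in> CX) \<and>
     (\<forall>f\<in>CX. \<forall>g\<in>CX. A (\<lambda>x. f x + g x) = (\<lambda>x. A f x + A g x)) \<and>
     (\<forall>c::real. \<forall>f\<in>CX. A (\<lambda>x. c * f x) = (\<lambda>x. c * A f x)) \<and>
     (\<forall>f\<in>CX. (\<forall>x. 0 \<le> f x) \<longrightarrow> (\<forall>x. 0 \<le> A f x))"

definition transfer_operator ::
  "('a::topological_space \<Rightarrow> 'a) \<Rightarrow> (('a \<Rightarrow> real) \<Rightarrow> ('a \<Rightarrow> real)) \<Rightarrow> bool" where
  "transfer_operator \<alpha> A \<longleftrightarrow> positive_linear_op A \<and>
     (\<forall>f\<in>CX. \<forall>g\<in>CX. A (\<lambda>x. delta \<alpha> f x * g x) = (\<lambda>x. f x * A g x))"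

definition Aphi :: "(('a \<Rightarrow> real) \<Rightarrow> ('a \<Rightarrow> real)) \<Rightarrow> ('a \<Rightarrow> real) \<Rightarrow> ('a \<Rightarrow> real) \<Rightarrow> ('a \<Rightarrow> real)" where
  "Aphi A \<phi> f = A (\<lambda>x. exp (\<phi> x) * f x)"

definition spec_lambda :: "(('a \<Rightarrow> real) \<Rightarrow> ('a \<Rightarrow> real)) \<Rightarrow> ('a \<Rightarrow> real) \<Rightarrow> ereal" where
  "spec_lambda A \<phi> = lim (\<lambda>n. eln (supnorm ((Aphi A \<phi> ^^ n) \<one>)) / ereal (real n))"

definition MC :: "(('a::topological_space \<Rightarrow> real) \<Rightarrow> real) set" where
  "MC = {m. (\<forall>f\<in>CX. \<forall>g\<in>CX. m (\<lambda>x. f x + g x) = m f + m g) \<and>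
            (\<forall>c::real. \<forall>f\<in>CX. m (\<lambda>x. c * f x) = c * m f) \<and>
            (\<forall>f\<in>CX. (\<forall>x. 0 \<le> f x) \<longrightarrow> 0 \<le> m f) \<and>
            m \<one> = 1}"

definition Mdelta :: "('a::topological_space \<Rightarrow> 'a) \<Rightarrow> (('a \<Rightarrow> real) \<Rightarrow> real) set" where
  "Mdelta \<alpha> = {\<mu>\<in>MC. \<forall>f\<in>CX. \<mu> (delta \<alpha> f) = \<mu> f}"

definition partitions_of_unity :: "('a::topological_space \<Rightarrow> real) set set" where
  "partitions_of_unity = {D. finite D \<and> D \<subseteq> CX \<and> (\<forall>g\<in>D. \<forall>x. 0 \<le> g x) \<and>
                             (\<lambda>x. \<Sum>g\<in>D. g x) = \<one>}"

definition tau_nD :: "(('a::topological_space \<Rightarrow> real) \<Rightarrow> ('a \<Rightarrow> real)) \<Rightarrow> nat \<Rightarrow>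
    (('a \<Rightarrow> real) \<Rightarrow> real) \<Rightarrow> ('a \<Rightarrow> real) set \<Rightarrow> ereal" where
  "tau_nD A n \<mu> D = (SUP m\<in>MC. \<Sum>g\<in>{g\<in>D. \<mu> g \<noteq> 0}.
        ereal (\<mu> g) * eln (m ((A ^^ n) g) / \<mu> g))"

definition tau_n :: "(('a::topological_space \<Rightarrow> real) \<Rightarrow> ('a \<Rightarrow> real)) \<Rightarrow> nat \<Rightarrow>
    (('a \<Rightarrow> real) \<Rightarrow> real) \<Rightarrow> ereal" where
  "tau_n A n \<mu> = (INF D\<in>partitions_of_unity. tau_nD A n \<mu> D)"

definition t_entropy :: "(('a::topological_space \<Rightarrow> real) \<Rightarrow> ('a \<Rightarrow> real)) \<Rightarrow>
    (('a \<Rightarrow> real) \<Rightarrow> real) \<Rightarrow> ereal" where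
  "t_entropy A \<mu> = (INF n\<in>{1..}. tau_n A n \<mu> / ereal (real n))"

end

theory Submission
  imports Defs
begin

text \<open>
  Upper bound: on a partition of unity on whose members the Birkhoff sum \<open>S\<^sub>n\<phi>\<close> is almost
  constant, Jensen's inequality bounds \<open>\<tau>\<^sub>n(\<mu>, D) + n \<mu>[\<phi>]\<close> by \<open>ln \<parallel>A\<^sub>\<phi>\<^sup>n \<one>\<parallel>\<close>, up to a small error.

  Attainment: let \<open>x\<^sub>n\<close> be a maximum point of \<open>A\<^sub>\<phi>\<^sup>n \<one>\<close> and \<open>m\<^sub>n[f] = A\<^sub>\<phi>\<^sup>n f (x\<^sub>n) / A\<^sub>\<phi>\<^sup>n \<one> (x\<^sub>n)\<close>.
  A weak-star cluster point \<open>\<mu>\<close> of \<open>f \<mapsto> m\<^sub>n[S\<^sub>n f] / n\<close> is invariant, and Jensen's inequality gives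
  \<open>\<lambda>(\<psi>) \<ge> \<lambda>(\<phi>) + \<mu>[\<psi> - \<phi>]\<close> for all \<open>\<psi>\<close>. Given \<open>n\<close> and \<open>D\<close>, maximise the concave function
  \<open>m \<mapsto> \<Sum>g. \<mu>[g] ln (m[A\<^sup>n g] / \<mu>[g])\<close>; the first-order condition at the maximum \<open>m\<^sub>0\<close> says that
  \<open>w = \<Sum>g. (\<mu>[g] / m\<^sub>0[A\<^sup>n g]) g\<close> satisfies \<open>A\<^sup>n w \<le> 1\<close>. Hence \<open>\<psi> = (ln w) / n\<close> has \<open>\<lambda>(\<psi>) \<le> 0\<close>,
  while \<open>n \<mu>[\<psi>] \<ge> - \<tau>\<^sub>n(\<mu>, D)\<close> by concavity of the logarithm, so that
  \<open>\<lambda>(\<phi>) - \<mu>[\<phi>] \<le> \<tau>\<^sub>n(\<mu>, D) / n\<close>.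
\<close>

subsection \<open>Positive linear functionals on continuous functions\<close>

lemma CX_const: "(\<lambda>x. c) \<in> CX"
  and CX_one: "\<one> \<in> CX"
  and CX_add: "f \<in> CX \<Longrightarrow> g \<in> CX \<Longrightarrow> (\<lambda>x. f x + g x) \<in> CX"
  and CX_diff: "f \<in> CX \<Longrightarrow> g \<in> CX \<Longrightarrow> (\<lambda>x. f x - g x) \<in> CX"
  and CX_mult: "f \<in> CX \<Longrightarrow> g \<in> CX \<Longrightarrow> (\<lambda>x. f x * g x) \<in> CX"
  and CX_exp: "f \<in> CX \<Longrightarrow> (\<lambda>x. exp (f x)) \<in> CX"
  by (auto simp: CX_def one_fun_def intro!: continuous_intros)

lemmas CX_intros = CX_const CX_one CX_add CX_diff CX_mult CX_exp

lemma CX_sum: "(\<And>i. i \<in> I \<Longrightarrow> f i \<in> CX) \<Longrightarrow> (\<lambda>x. \<Sum>i\<in>I. f i x) \<in> CX"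
  by (auto simp: CX_def intro!: continuous_intros)

lemma CX_ln: "f \<in> CX \<Longrightarrow> (\<And>x. 0 < f x) \<Longrightarrow> (\<lambda>x. ln (f x)) \<in> CX"
  by (auto simp: CX_def intro!: continuous_intros) (metis less_irrefl)

lemma CX_comp: "f \<in> CX \<Longrightarrow> continuous_on UNIV \<alpha> \<Longrightarrow> (\<lambda>x. f (\<alpha> x)) \<in> CX"
  unfolding CX_def using continuous_on_compose2[of UNIV f UNIV \<alpha>] by auto

lemma one_fun_apply: "\<one> x = 1"
  by (simp add: one_fun_def)

lemma continuous_on_funpow:
  fixes \<alpha> :: "'a::topological_space \<Rightarrow> 'a"
  shows "continuous_on UNIV \<alpha> \<Longrightarrow> continuous_on UNIV (\<alpha> ^^ n)"
proof (induction n)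
  case (Suc n)
  then show ?case
    using continuous_on_compose2[of UNIV \<alpha> UNIV "\<alpha> ^^ n"] by (simp add: o_def)
qed (simp add: id_def)

section \<open>The supremum norm on a compact space\<close>

lemma CX_abs_bounded:
  fixes f :: "'a::topological_space \<Rightarrow> real"
  assumes "compact (UNIV :: 'a set)" "f \<in> CX"
  shows "bdd_above (range (\<lambda>x. \<bar>f x\<bar>))"
proof -
  have "compact (range f)"
    using assms compact_continuous_image unfolding CX_def by blast
  then obtain B where "\<forall>y\<in>range f. norm y \<le> B"
    using compact_imp_bounded bounded_iff by metis
  then show ?thesis
    unfolding bdd_above_def by auto
qed

lemma abs_le_supnorm:
  fixes f :: "'a::topological_space \<Rightarrow> real"
  assumes "compact (UNIV :: 'a set)" "f \<in> CX"
  shows "\<bar>f x\<bar> \<le> supnorm f"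
  unfolding supnorm_def by (rule cSUP_upper[OF _ CX_abs_bounded[OF assms]]) simp

lemma supnorm_le: "(\<And>x. \<bar>f x\<bar> \<le> c) \<Longrightarrow> supnorm f \<le> c"
  unfolding supnorm_def by (rule cSUP_least) auto

lemma supnorm_attained:
  fixes f :: "'a::topological_space \<Rightarrow> real"
  assumes "compact (UNIV :: 'a set)" "f \<in> CX"
  obtains x where "supnorm f = \<bar>f x\<bar>"
proof -
  have "continuous_on UNIV (\<lambda>x. \<bar>f x\<bar>)"
    using assms by (auto simp: CX_def intro!: continuous_intros)
  then obtain x where "\<forall>y. \<bar>f y\<bar> \<le> \<bar>f x\<bar>"
    using continuous_attains_sup[OF assms(1)] by (metis UNIV_I UNIV_not_empty)
  then have "supnorm f = \<bar>f x\<bar>"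
    using abs_le_supnorm[OF assms, of x] supnorm_le[of f "\<bar>f x\<bar>"] by (simp add: antisym)
  then show thesis using that by blast
qed

text \<open>Members of \<open>MC\<close> without the normalisation: \<open>\<lambda>f. B f x\<close>
  and \<open>\<lambda>f. m (B f)\<close> belong here, although their value at \<open>\<one>\<close>
  is in general not 1.\<close>

definition poslin :: "(('a::topological_space \<Rightarrow> real) \<Rightarrow> real) \<Rightarrow> bool" where
  "poslin m \<longleftrightarrow> (\<forall>f\<in>CX. \<forall>g\<in>CX. m (\<lambda>x. f x + g x) = m f + m g) \<and>
            (\<forall>c::real. \<forall>f\<in>CX. m (\<lambda>x. c * f x) = c * m f) \<and>
            (\<forall>f\<in>CX. (\<forall>x. 0 \<le> f x) \<longrightarrow> 0 \<le> m f)"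

lemma MC_iff: "m \<in> MC \<longleftrightarrow> poslin m \<and> m \<one> = 1"
  by (auto simp: MC_def poslin_def)

lemma poslin_add: "poslin m \<Longrightarrow> f \<in> CX \<Longrightarrow> g \<in> CX \<Longrightarrow> m (\<lambda>x. f x + g x) = m f + m g"
  and poslin_scale: "poslin m \<Longrightarrow> f \<in> CX \<Longrightarrow> m (\<lambda>x. c * f x) = c * m f"
  and poslin_nonneg: "poslin m \<Longrightarrow> f \<in> CX \<Longrightarrow> (\<And>x. 0 \<le> f x) \<Longrightarrow> 0 \<le> m f"
  by (auto simp: poslin_def)

lemma poslin_const: "poslin m \<Longrightarrow> m (\<lambda>x. c) = c * m \<one>"
  using poslin_scale[of m \<one> c] CX_one by (simp add: one_fun_def)

lemma poslin_diff:
  assumes "poslin m" "f \<in> CX" "g \<in> CX"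
  shows "m (\<lambda>x. f x - g x) = m f - m g"
  using poslin_add[of m "\<lambda>x. f x - g x" g] assms CX_diff[of f g] by simp

lemma poslin_mono:
  assumes "poslin m" "f \<in> CX" "g \<in> CX" "\<And>x. f x \<le> g x"
  shows "m f \<le> m g"
  using poslin_nonneg[of m "\<lambda>x. g x - f x"] poslin_diff[of m g f] CX_diff[of g f] assms by simp

lemma poslin_sum:
  assumes "poslin m" "finite I" "\<And>i. i \<in> I \<Longrightarrow> f i \<in> CX"
  shows "m (\<lambda>x. \<Sum>i\<in>I. f i x) = (\<Sum>i\<in>I. m (f i))"
  using assms(2,3)
proof (induction I)
  case empty
  then show ?case using poslin_const[OF assms(1), of 0] by simp
next
  case (insert i I)
  then show ?case
    using poslin_add[OF assms(1), of "f i" "\<lambda>x. \<Sum>i\<in>I. f i x"] CX_sum[of I f] by simp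
qed

lemma poslin_le_supnorm:
  fixes m :: "('a::topological_space \<Rightarrow> real) \<Rightarrow> real"
  assumes "compact (UNIV :: 'a set)" "poslin m" "f \<in> CX"
  shows "\<bar>m f\<bar> \<le> supnorm f * m \<one>"
proof -
  note b = abs_le_supnorm[OF assms(1,3)]
  have "m f \<le> m (\<lambda>x. supnorm f)"
    using assms b by (intro poslin_mono[OF assms(2)] CX_const) (auto intro: order_trans[OF abs_ge_self])
  moreover have "m (\<lambda>x. - supnorm f) \<le> m f"
  proof (intro poslin_mono[OF assms(2)] assms CX_const)
    show "- supnorm f \<le> f x" for x using b[of x] by linarith
  qed
  ultimately show ?thesis
    using poslin_const[OF assms(2)] by (metis abs_le_iff minus_le_iff mult_minus_left)
qed

lemma poslin_eval: "poslin (\<lambda>f. f x)"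
  by (auto simp: poslin_def)

lemma eval_in_MC: "(\<lambda>f. f x) \<in> MC"
  by (simp add: MC_iff poslin_eval one_fun_apply)

text \<open>Jensen's inequality for \<open>exp\<close>: the tangent line at \<open>m f\<close> lies
  below \<open>exp\<close>, and a positive normalised \<open>m\<close> preserves this
  comparison.\<close>

lemma exp_poslin_le:
  assumes "m \<in> MC" "f \<in> CX"
  shows "exp (m f) \<le> m (\<lambda>x. exp (f x))"
proof -
  have m: "poslin m" "m \<one> = 1" using assms(1) by (auto simp: MC_iff)
  let ?a = "m f"
  have f': "(\<lambda>x. (1 - ?a) + f x) \<in> CX" by (intro CX_intros assms)
  have "m (\<lambda>x. exp ?a * ((1 - ?a) + f x)) \<le> m (\<lambda>x. exp (f x))"
  proof (rule poslin_mono[OF m(1)])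
    fix x
    have "exp ?a * (1 + (f x - ?a)) \<le> exp ?a * exp (f x - ?a)"
      by (intro mult_left_mono) (auto simp: exp_ge_add_one_self)
    then show "exp ?a * ((1 - ?a) + f x) \<le> exp (f x)"
      by (simp add: exp_diff algebra_simps)
  qed (intro CX_intros assms)+
  moreover have "m (\<lambda>x. exp ?a * ((1 - ?a) + f x)) = exp ?a * ((1 - ?a) + m f)"
    using poslin_scale[OF m(1) f'] poslin_add[OF m(1) CX_const assms(2), of "1 - ?a"]
      poslin_const[OF m(1), of "1 - ?a"] m(2) by simp
  ultimately show ?thesis by simp
qed

subsection \<open>Powers of transfer operators\<close>

lemma positive_linear_op_poslin:
  assumes "positive_linear_op B"
  shows "poslin (\<lambda>f. B f x)"
  using assms unfolding positive_linear_op_def poslin_def by auto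

lemma positive_linear_op_CX: "positive_linear_op B \<Longrightarrow> f \<in> CX \<Longrightarrow> B f \<in> CX"
  by (auto simp: positive_linear_op_def)

lemma poslin_compose:
  assumes "poslin m" "positive_linear_op B"
  shows "poslin (\<lambda>f. m (B f))"
  using assms unfolding positive_linear_op_def poslin_def by auto

lemma positive_linear_op_funpow:
  fixes B :: "('a::topological_space \<Rightarrow> real) \<Rightarrow> ('a \<Rightarrow> real)"
  assumes "positive_linear_op B"
  shows "positive_linear_op (B ^^ n)"
proof (induction n)
  case (Suc n)
  then show ?case using assms unfolding positive_linear_op_def by auto
qed (auto simp: positive_linear_op_def)

lemma positive_linear_op_Aphi:
  assumes "positive_linear_op A" "\<phi> \<in> CX"
  shows "positive_linear_op (Aphi A \<phi>)"
proof -
  define e where "e f = (\<lambda>x. exp (\<phi> x) * f x)" for f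
  have e: "e f \<in> CX" if "f \<in> CX" for f
    unfolding e_def by (intro CX_intros assms that)
  have Ae: "Aphi A \<phi> f = A (e f)" for f
    by (simp add: Aphi_def e_def)
  have "e (\<lambda>x. f x + g x) = (\<lambda>x. e f x + e g x)" "e (\<lambda>x. c * f x) = (\<lambda>x. c * e f x)" for f g c
    by (simp_all add: e_def algebra_simps)
  moreover have "0 \<le> e f x" if "\<forall>x. 0 \<le> f x" for f x
    using that by (simp add: e_def)
  ultimately show ?thesis
    using assms(1) e unfolding positive_linear_op_def Ae by simp
qed

lemma transfer_operatorD:
  assumes "transfer_operator \<alpha> A" "f \<in> CX" "g \<in> CX"
  shows "A (\<lambda>x. f (\<alpha> x) * g x) = (\<lambda>x. f x * A g x)"
proof -
  have "\<forall>f\<in>CX. \<forall>g\<in>CX. A (\<lambda>x. delta \<alpha> f x * g x) = (\<lambda>x. f x * A g x)"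
    using assms(1) unfolding transfer_operator_def by (rule conjunct2)
  from bspec[OF bspec[OF this assms(2)] assms(3)] show ?thesis
    unfolding delta_def o_apply .
qed

text \<open>Each application of \<open>A\<close> strips one composition with
  \<open>\<alpha>\<close>. The formula for weighted iterates thereby becomes available for
  \<open>\<alpha> ^^ n\<close> and \<open>A ^^ n\<close> too.\<close>

lemma transfer_operator_funpow:
  assumes "transfer_operator \<alpha> A" "continuous_on UNIV \<alpha>"
  shows "transfer_operator (\<alpha> ^^ n) (A ^^ n)"
proof -
  have pos: "positive_linear_op (A ^^ k)" for k
    using assms positive_linear_op_funpow unfolding transfer_operator_def by blast
  have "(A ^^ n) (\<lambda>x. delta (\<alpha> ^^ n) f x * g x) = (\<lambda>x. f x * (A ^^ n) g x)"
    if fg: "f \<in> CX" "g \<in> CX" for f g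
    using fg(1)
  proof (induction n arbitrary: f)
    case 0
    show ?case by (simp add: delta_def)
  next
    case (Suc n)
    have "(\<lambda>x. f (\<alpha> x)) \<in> CX" using Suc.prems assms(2) by (rule CX_comp)
    then have "(A ^^ n) (\<lambda>x. delta (\<alpha> ^^ n) (\<lambda>x. f (\<alpha> x)) x * g x)
      = (\<lambda>x. f (\<alpha> x) * (A ^^ n) g x)"
      by (rule Suc.IH)
    moreover have "A (\<lambda>x. f (\<alpha> x) * (A ^^ n) g x) = (\<lambda>x. f x * A ((A ^^ n) g) x)"
      by (intro transfer_operatorD assms Suc.prems positive_linear_op_CX[OF pos] fg)
    ultimately show ?case by (simp add: delta_def)
  qed
  then show ?thesis unfolding transfer_operator_def by (intro conjI pos ballI)
qed

lemmas transfer_operator_pull_out = transfer_operatorD[OF transfer_operator_funpow]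

section \<open>Birkhoff sums and iterates of the weighted operator\<close>

definition birkhoff_sum :: "('a \<Rightarrow> 'a) \<Rightarrow> nat \<Rightarrow> ('a \<Rightarrow> real) \<Rightarrow> 'a \<Rightarrow> real" where
  "birkhoff_sum \<alpha> n f x = (\<Sum>i<n. f ((\<alpha> ^^ i) x))"

lemma CX_birkhoff_sum:
  "continuous_on UNIV \<alpha> \<Longrightarrow> f \<in> CX \<Longrightarrow> birkhoff_sum \<alpha> n f \<in> CX"
  unfolding birkhoff_sum_def[abs_def] by (rule CX_sum, rule CX_comp[OF _ continuous_on_funpow])

text \<open>The weight of the outermost application is pulled into \<open>A ^^ n\<close>, where it
  becomes \<open>exp\<close> of \<open>\<phi> \<circ> (\<alpha> ^^ n)\<close>, the last summand of
  the longer Birkhoff sum.\<close>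

lemma Aphi_funpow:
  assumes "transfer_operator \<alpha> A" "continuous_on UNIV \<alpha>" "\<phi> \<in> CX" "f \<in> CX"
  shows "(Aphi A \<phi> ^^ n) f = (A ^^ n) (\<lambda>x. exp (birkhoff_sum \<alpha> n \<phi> x) * f x)"
proof (induction n)
  case 0
  show ?case by (simp add: birkhoff_sum_def)
next
  case (Suc n)
  let ?g = "\<lambda>x. exp (birkhoff_sum \<alpha> n \<phi> x) * f x"
  have g: "?g \<in> CX" by (intro CX_intros CX_birkhoff_sum assms)
  have "(Aphi A \<phi> ^^ Suc n) f = A (\<lambda>x. exp (\<phi> x) * (A ^^ n) ?g x)"
    by (simp add: Suc Aphi_def)
  also have "(\<lambda>x. exp (\<phi> x) * (A ^^ n) ?g x) = (A ^^ n) (\<lambda>x. exp (\<phi> ((\<alpha> ^^ n) x)) * ?g x)"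
    using transfer_operator_pull_out[OF assms(1,2) CX_exp[OF assms(3)] g, of n] by simp
  also have "(\<lambda>x. exp (\<phi> ((\<alpha> ^^ n) x)) * ?g x) = (\<lambda>x. exp (birkhoff_sum \<alpha> (Suc n) \<phi> x) * f x)"
    by (simp add: birkhoff_sum_def exp_add algebra_simps)
  finally show ?case by simp
qed

lemma Aphi_funpow_one:
  assumes "transfer_operator \<alpha> A" "continuous_on UNIV \<alpha>" "\<phi> \<in> CX"
  shows "(Aphi A \<phi> ^^ n) \<one> = (A ^^ n) (\<lambda>x. exp (birkhoff_sum \<alpha> n \<phi> x))"
  using Aphi_funpow[OF assms CX_one] by (simp add: one_fun_apply)

lemma funpow_one_le_power:
  assumes "positive_linear_op B" "\<And>x. B \<one> x \<le> C" "0 \<le> C"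
  shows "(B ^^ n) \<one> x \<le> C ^ n"
proof (induction n arbitrary: x)
  case (Suc n)
  have "B ((B ^^ n) \<one>) x \<le> B (\<lambda>_. C ^ n) x"
    by (intro poslin_mono[OF positive_linear_op_poslin[OF assms(1)]] Suc CX_const CX_one
        positive_linear_op_CX[OF positive_linear_op_funpow[OF assms(1)]])
  also have "\<dots> = C ^ n * B \<one> x"
    by (rule poslin_const[OF positive_linear_op_poslin[OF assms(1)]])
  also have "\<dots> \<le> C ^ n * C"
    using assms by (intro mult_left_mono) auto
  finally show ?case by (simp add: mult.commute)
qed (simp add: one_fun_apply)

lemma positive_linear_op_one_nonneg: "positive_linear_op B \<Longrightarrow> 0 \<le> B \<one> x"
  using poslin_nonneg[OF positive_linear_op_poslin CX_one] by (simp add: one_fun_apply)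

lemma positive_linear_op_one_le_supnorm:
  fixes B :: "('a::topological_space \<Rightarrow> real) \<Rightarrow> ('a \<Rightarrow> real)"
  assumes "compact (UNIV :: 'a set)" "positive_linear_op B"
  shows "B \<one> x \<le> supnorm (B \<one>)"
  by (rule order_trans[OF abs_ge_self abs_le_supnorm[OF assms(1) positive_linear_op_CX[OF assms(2) CX_one]]])

lemma supnorm_one_nonneg:
  fixes B :: "('a::topological_space \<Rightarrow> real) \<Rightarrow> ('a \<Rightarrow> real)"
  assumes "compact (UNIV :: 'a set)" "positive_linear_op B"
  shows "0 \<le> supnorm (B \<one>)"
  by (rule order_trans[OF abs_ge_zero abs_le_supnorm[OF assms(1) positive_linear_op_CX[OF assms(2) CX_one]]])

text \<open>Positivity lets the bound of \<open>(B ^^ k) \<one>\<close> by its norm pass through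
  \<open>B ^^ n\<close>. This supplies the hypothesis of Fekete's lemma.\<close>

lemma supnorm_funpow_one_submult:
  fixes B :: "('a::topological_space \<Rightarrow> real) \<Rightarrow> ('a \<Rightarrow> real)"
  assumes "compact (UNIV :: 'a set)" "positive_linear_op B"
  shows "supnorm ((B ^^ (n + k)) \<one>) \<le> supnorm ((B ^^ n) \<one>) * supnorm ((B ^^ k) \<one>)"
proof (rule supnorm_le)
  fix x
  note P = positive_linear_op_funpow[OF assms(2)]
  have "(B ^^ (n + k)) \<one> x = (B ^^ n) ((B ^^ k) \<one>) x"
    by (simp add: funpow_add)
  also have "\<dots> \<le> (B ^^ n) (\<lambda>x. supnorm ((B ^^ k) \<one>)) x"
    by (intro poslin_mono[OF positive_linear_op_poslin[OF P]] positive_linear_op_CX[OF P] CX_const CX_one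
       positive_linear_op_one_le_supnorm[OF assms(1) P])
  also have "\<dots> = supnorm ((B ^^ k) \<one>) * (B ^^ n) \<one> x"
    by (rule poslin_const[OF positive_linear_op_poslin[OF P]])
  also have "\<dots> \<le> supnorm ((B ^^ k) \<one>) * supnorm ((B ^^ n) \<one>)"
    by (intro mult_left_mono positive_linear_op_one_le_supnorm[OF assms(1) P] supnorm_one_nonneg[OF assms(1) P])
  finally show "\<bar>(B ^^ (n + k)) \<one> x\<bar> \<le> supnorm ((B ^^ n) \<one>) * supnorm ((B ^^ k) \<one>)"
    using positive_linear_op_one_nonneg[OF P, of "n + k" x] by (simp only: abs_of_nonneg mult.commute)
qed

subsection \<open>The spectral potential as an infimum\<close>

text \<open>Turns estimates of \<open>eln\<close> into estimates without logarithms; for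
  \<open>x \<le> 0\<close> both sides hold, the left one because \<open>eln x\<close> is
  \<open>-\<infinity>\<close>.\<close>

lemma eln_divide_le_iff:
  assumes "0 < n"
  shows "eln x / ereal (real n) \<le> ereal c \<longleftrightarrow> x \<le> exp (c * real n)"
proof (cases "x > 0")
  case True
  have "eln x / ereal (real n) \<le> ereal c \<longleftrightarrow> ln x \<le> c * real n"
    using True assms by (simp add: eln_def divide_le_eq)
  also have "\<dots> \<longleftrightarrow> x \<le> exp (c * real n)"
    using True by (metis exp_le_cancel_iff exp_ln)
  finally show ?thesis .
next
  case False
  then show ?thesis
    using assms order_trans[of x 0 "exp (c * real n)"] by (simp add: eln_def divide_ereal_def)
qed

text \<open>After division by \<open>exp (c * real n)\<close> the sequence is still
  submultiplicative and at most 1 at \<open>p\<close>, so its values are controlled by those at the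
  residues modulo \<open>p\<close>.\<close>

lemma submult_growth:
  fixes L :: "nat \<Rightarrow> real"
  assumes nonneg: "\<And>n. 0 \<le> L n" and submult: "\<And>n k. L (n + k) \<le> L n * L k"
    and "0 < p" and Lp: "L p \<le> exp (c * real p)"
  obtains K where "1 \<le> K" "\<And>n. L n \<le> K * exp (c * real n)"
proof
  define M where "M n = L n * exp (- (c * real n))" for n
  have M0: "0 \<le> M n" for n using nonneg by (simp add: M_def)
  have sub: "M (n + k) \<le> M n * M k" for n k
  proof -
    have "M (n + k) \<le> (L n * L k) * exp (- (c * real (n + k)))"
      unfolding M_def by (intro mult_right_mono submult) simp
    also have "\<dots> = M n * M k"
      by (simp add: M_def exp_add[symmetric] algebra_simps)
    finally show ?thesis .
  qed
  have Mp: "M p \<le> 1"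
    using Lp by (simp add: M_def exp_minus field_simps)
  have step: "M (k * p + r) \<le> M r" for k r
  proof (induction k)
    case (Suc k)
    have "M (Suc k * p + r) \<le> M p * M (k * p + r)"
      using sub[of p "k * p + r"] by (simp add: add.assoc)
    also have "\<dots> \<le> M (k * p + r)" by (rule mult_left_le_one_le[OF M0 M0 Mp])
    finally show ?case using Suc by simp
  qed simp
  \<comment> \<open>Adding 1 keeps the constant positive even if all \<open>M r\<close> vanish, so
    that its logarithm can be taken.\<close>
  let ?K = "1 + (\<Sum>r<p. M r)"
  show "1 \<le> ?K" using M0 by (simp add: sum_nonneg)
  fix n
  have "M n \<le> M (n mod p)" using step[of "n div p" "n mod p"] by simp
  also have "\<dots> \<le> (\<Sum>r<p. M r)"
    using M0 assms(3) by (intro member_le_sum) auto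
  finally have "M n \<le> ?K" by simp
  then show "L n \<le> ?K * exp (c * real n)"
    by (simp add: M_def exp_minus field_simps)
qed

text \<open>Fekete's lemma in multiplicative form; the values \<open>L n = 0\<close>, and a limit \<open>-\<infinity>\<close>, are allowed.\<close>

lemma submult_eln_limit:
  fixes L :: "nat \<Rightarrow> real"
  assumes "\<And>n. 0 \<le> L n" "\<And>n k. L (n + k) \<le> L n * L k"
  shows "(\<lambda>n. eln (L n) / ereal (real n)) \<longlonglongrightarrow> (INF n\<in>{1..}. eln (L n) / ereal (real n))"
    (is "?a \<longlonglongrightarrow> ?I")
proof (rule order_tendstoI)
  fix a assume "a < ?I"
  then have "a < ?a n" if "n \<ge> 1" for n
    using that by (intro less_INF_D[of a ?a "{1..}"]) auto
  then show "\<forall>\<^sub>F n in sequentially. a < ?a n"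
    unfolding eventually_sequentially by blast
next
  fix a assume "?I < a"
  then obtain p where p: "p \<ge> 1" "?a p < a" by (auto simp: INF_less_iff)
  obtain c where c: "?a p < ereal c" "ereal c < a" using ereal_dense2[OF p(2)] by blast
  \<comment> \<open>The gap between \<open>c\<close> and \<open>c'\<close> absorbs the constant
    \<open>K\<close> for large \<open>n\<close>.\<close>
  obtain c' where c': "ereal c < ereal c'" "ereal c' < a" using ereal_dense2[OF c(2)] by blast
  have "L p \<le> exp (c * real p)" using eln_divide_le_iff[of p "L p" c] p c by (simp add: less_imp_le)
  with assms p(1) obtain K where K: "1 \<le> K" "\<And>n. L n \<le> K * exp (c * real n)"
    using submult_growth[of L p c] by (metis One_nat_def Suc_le_lessD)
  obtain N where N: "ln K / (c' - c) \<le> real N" using real_arch_simple by blast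
  have "?a n < a" if n: "n \<ge> Suc N" for n
  proof -
    have "ln K / (c' - c) \<le> real n" using N n by simp
    then have "ln K + c * real n \<le> c' * real n"
      using c'(1) by (simp add: field_simps)
    then have "exp (ln K + c * real n) \<le> exp (c' * real n)" by simp
    then have "K * exp (c * real n) \<le> exp (c' * real n)" using K(1) by (simp add: exp_add)
    then have "L n \<le> exp (c' * real n)" using K(2)[of n] by simp
    then have "?a n \<le> ereal c'" using eln_divide_le_iff[of n "L n" c'] n by simp
    then show ?thesis using c'(2) by (rule order.strict_trans1)
  qed
  then show "\<forall>\<^sub>F n in sequentially. ?a n < a"
    unfolding eventually_sequentially by blast
qed

text \<open>Fekete's lemma makes the limit exist, so that each single \<open>n \<ge> 1\<close>
  already bounds the spectral potential from above.\<close>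

lemma spec_lambda_eq_INF:
  fixes A :: "('a::topological_space \<Rightarrow> real) \<Rightarrow> ('a \<Rightarrow> real)"
  assumes "compact (UNIV :: 'a set)" "positive_linear_op A" "\<phi> \<in> CX"
  shows "spec_lambda A \<phi> = (INF n\<in>{1..}. eln (supnorm ((Aphi A \<phi> ^^ n) \<one>)) / ereal (real n))"
proof -
  note P = positive_linear_op_Aphi[OF assms(2,3)]
  show ?thesis
    unfolding spec_lambda_def
    by (intro limI submult_eln_limit supnorm_funpow_one_submult[OF assms(1) P]
        supnorm_one_nonneg[OF assms(1) positive_linear_op_funpow[OF P]])
qed

lemma spec_lambda_less_imp_growth:
  fixes A :: "('a::topological_space \<Rightarrow> real) \<Rightarrow> ('a \<Rightarrow> real)"
  assumes "compact (UNIV :: 'a set)" "positive_linear_op A" "\<phi> \<in> CX" "spec_lambda A \<phi> < ereal c"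
  obtains K where "1 \<le> K" "\<And>n. supnorm ((Aphi A \<phi> ^^ n) \<one>) \<le> K * exp (c * real n)"
proof -
  note P = positive_linear_op_Aphi[OF assms(2,3)]
  obtain p where p: "p \<ge> 1" "eln (supnorm ((Aphi A \<phi> ^^ p) \<one>)) / ereal (real p) < ereal c"
    using assms(4) unfolding spec_lambda_eq_INF[OF assms(1-3)] by (auto simp: INF_less_iff)
  then have "supnorm ((Aphi A \<phi> ^^ p) \<one>) \<le> exp (c * real p)"
    using eln_divide_le_iff[of p "supnorm ((Aphi A \<phi> ^^ p) \<one>)" c] by (simp add: less_imp_le)
  then show thesis
    using p(1) submult_growth[of "\<lambda>n. supnorm ((Aphi A \<phi> ^^ n) \<one>)" p c, OF _ _ _ _ that]
      supnorm_funpow_one_submult[OF assms(1) P]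
      supnorm_one_nonneg[OF assms(1) positive_linear_op_funpow[OF P]] by simp
qed

text \<open>
  If \<open>e\<^sup>n\<^sup>\<psi>\<close> is used as a single weight for the \<open>n\<close>-th power of \<open>A\<close>, the resulting potential still
  controls \<open>\<lambda>(\<psi>)\<close>: the Birkhoff sum of \<open>\<psi>\<close> of length \<open>n(k + 1)\<close> is, up to a bounded error, the mean over
  \<open>i < n\<close> of the sums \<open>T \<circ> \<alpha>\<^sup>i\<close>, where \<open>T\<close> is the sum of \<open>n\<psi>\<close> of length \<open>k\<close> along \<open>\<alpha>\<^sup>n\<close>.
\<close>

lemma spec_lambda_le_ln_divide:
  fixes A :: "('a::topological_space \<Rightarrow> real) \<Rightarrow> ('a \<Rightarrow> real)"
  assumes comp: "compact (UNIV :: 'a set)" and cont: "continuous_on UNIV \<alpha>"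
    and tr: "transfer_operator \<alpha> A" and \<psi>: "\<psi> \<in> CX" and n: "0 < n" and C: "0 < C"
    and le: "\<And>x. (A ^^ n) (\<lambda>x. exp (real n * \<psi> x)) x \<le> C"
  shows "spec_lambda A \<psi> \<le> ereal (ln C / real n)"
proof -
  define T where "T k = birkhoff_sum (\<alpha> ^^ n) k (\<lambda>x. real n * \<psi> x)" for k
  define s where "s = supnorm \<psi>"
  \<comment> \<open>\<open>K\<close> collects the cost of the \<open>n\<close> leftover terms of the
    Birkhoff sum and of the \<open>i\<close> and \<open>n - i\<close> extra applications of
    \<open>A\<close> at the two ends.\<close>
  define K where "K = exp (real n * s) * (\<Sum>i<n. supnorm ((A ^^ i) \<one>) * supnorm ((A ^^ (n - i)) \<one>))"
  have pos: "positive_linear_op A" using tr unfolding transfer_operator_def by blast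
  note P = positive_linear_op_funpow[OF pos]
  note S = positive_linear_op_one_le_supnorm[OF comp P]
  note S0 = supnorm_one_nonneg[OF comp P]
  have n\<psi>: "(\<lambda>x. real n * \<psi> x) \<in> CX" by (intro CX_intros \<psi>)
  have T_CX: "T k \<in> CX" for k
    unfolding T_def by (intro CX_birkhoff_sum continuous_on_funpow cont n\<psi>)
  have Tcomp_CX: "(\<lambda>x. T k ((\<alpha> ^^ i) x)) \<in> CX" for k i
    by (rule CX_comp[OF T_CX continuous_on_funpow[OF cont]])
  \<comment> \<open>\<open>T k\<close> is a Birkhoff sum for \<open>\<alpha> ^^ n\<close>, and the
    corresponding weighted operator built from \<open>A ^^ n\<close> maps \<open>\<one>\<close>
    below \<open>C\<close>.\<close>
  have AT: "(A ^^ (n * k)) (\<lambda>x. exp (T k x)) x \<le> C ^ k" for k x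
  proof -
    let ?B = "Aphi (A ^^ n) (\<lambda>x. real n * \<psi> x)"
    have "(?B ^^ k) \<one> x \<le> C ^ k"
    proof (rule funpow_one_le_power[OF positive_linear_op_Aphi[OF P n\<psi>]])
      show "?B \<one> x \<le> C" for x using le by (simp add: Aphi_def one_fun_apply)
    qed (use C in simp)
    then show ?thesis
      unfolding Aphi_funpow_one[OF transfer_operator_funpow[OF tr cont] continuous_on_funpow[OF cont] n\<psi>]
      by (simp add: T_def funpow_mult mult.commute)
  qed
  \<comment> \<open>The indices below \<open>k * n\<close> are sorted as \<open>j * n + i\<close>;
    the last \<open>n\<close> summands are bounded by \<open>s\<close> each.\<close>
  have S_le: "birkhoff_sum \<alpha> (n * Suc k) \<psi> x \<le> real n * s + (\<Sum>i<n. T k ((\<alpha> ^^ i) x)) / real n" for k x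
  proof -
    have "(\<Sum>i<n. T k ((\<alpha> ^^ i) x)) = (\<Sum>i<n. \<Sum>j<k. real n * \<psi> ((\<alpha> ^^ (j * n + i)) x))"
      by (simp add: T_def birkhoff_sum_def funpow_mult funpow_add mult.commute)
    also have "\<dots> = (\<Sum>j<k. \<Sum>i<n. real n * \<psi> ((\<alpha> ^^ (j * n + i)) x))"
      by (rule sum.swap)
    also have "\<dots> = (\<Sum>l<k * n. real n * \<psi> ((\<alpha> ^^ l) x))"
    proof -
      let ?g = "\<lambda>l. real n * \<psi> ((\<alpha> ^^ l) x)"
      have "(\<Sum>i<n. ?g (j * n + i)) = sum ?g {j * n..<j * n + n}" for j
        using sum.shift_bounds_nat_ivl[of ?g 0 "j * n" n] by (simp add: lessThan_atLeast0 add.commute)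
      then show ?thesis by (simp only: sum.nat_group)
    qed
    also have "\<dots> = real n * birkhoff_sum \<alpha> (n * k) \<psi> x"
      by (simp add: birkhoff_sum_def sum_distrib_left mult.commute)
    finally have "(\<Sum>i<n. T k ((\<alpha> ^^ i) x)) / real n = birkhoff_sum \<alpha> (n * k) \<psi> x"
      using n by simp
    moreover have "birkhoff_sum \<alpha> (n * Suc k) \<psi> x
      = birkhoff_sum \<alpha> (n * k) \<psi> x + (\<Sum>l\<in>{n * k..<n * k + n}. \<psi> ((\<alpha> ^^ l) x))"
      unfolding birkhoff_sum_def lessThan_atLeast0
      by (subst sum.atLeastLessThan_concat) (auto simp: add.commute)
    moreover have "(\<Sum>l\<in>{n * k..<n * k + n}. \<psi> ((\<alpha> ^^ l) x)) \<le> of_nat (card {n * k..<n * k + n}) * s"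
      unfolding s_def by (rule sum_bounded_above) (rule order_trans[OF abs_ge_self abs_le_supnorm[OF comp \<psi>]])
    ultimately show ?thesis by simp
  qed
  \<comment> \<open>At \<open>x\<close> some \<open>T k \<circ> (\<alpha> ^^ i)\<close> is at least
    the mean, and its exponential is at most the sum of all exponentials.\<close>
  have exp_le: "exp (birkhoff_sum \<alpha> (n * Suc k) \<psi> x)
    \<le> exp (real n * s) * (\<Sum>i<n. exp (T k ((\<alpha> ^^ i) x)))" for k x
  proof -
    let ?t = "\<lambda>i. T k ((\<alpha> ^^ i) x)"
    have "\<exists>i<n. (\<Sum>i<n. ?t i) / real n \<le> ?t i"
    proof (rule ccontr)
      assume "\<not> ?thesis"
      then have "(\<Sum>i<n. ?t i) < (\<Sum>i<n. (\<Sum>i<n. ?t i) / real n)"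
        using n by (intro sum_strict_mono) auto
      then show False using n by simp
    qed
    then obtain i where i: "i < n" "(\<Sum>i<n. ?t i) / real n \<le> ?t i" by blast
    have "exp (birkhoff_sum \<alpha> (n * Suc k) \<psi> x) \<le> exp (real n * s + ?t i)"
      using S_le[of k x] i(2) by simp
    also have "\<dots> = exp (real n * s) * exp (?t i)" by (rule exp_add)
    also have "\<dots> \<le> exp (real n * s) * (\<Sum>i<n. exp (?t i))"
      using i(1) by (intro mult_left_mono member_le_sum) auto
    finally show ?thesis .
  qed
  \<comment> \<open>From the inside out, \<open>A ^^ i\<close> strips the shift by
    \<open>\<alpha> ^^ i\<close>, \<open>A ^^ (n * k)\<close> meets \<open>exp (T k x)\<close>, and
    the remaining \<open>n - i\<close> applications cost a norm.\<close>
  have term_le: "(A ^^ (n * Suc k)) (\<lambda>x. exp (T k ((\<alpha> ^^ i) x))) x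
    \<le> (supnorm ((A ^^ i) \<one>) * supnorm ((A ^^ (n - i)) \<one>)) * C ^ k" if i: "i < n" for i k x
  proof -
    have "n * Suc k = (n - i) + (n * k + i)" using i by simp
    then have "(A ^^ (n * Suc k)) (\<lambda>x. exp (T k ((\<alpha> ^^ i) x))) x
      = (A ^^ (n - i)) ((A ^^ (n * k)) ((A ^^ i) (\<lambda>x. exp (T k ((\<alpha> ^^ i) x))))) x"
      by (simp only: funpow_add o_apply)
    also have "(A ^^ i) (\<lambda>x. exp (T k ((\<alpha> ^^ i) x))) = (\<lambda>x. exp (T k x) * (A ^^ i) \<one> x)"
      using transfer_operator_pull_out[OF tr cont CX_exp[OF T_CX] CX_one] by (simp add: one_fun_apply)
    also have "(A ^^ (n - i)) ((A ^^ (n * k)) (\<lambda>x. exp (T k x) * (A ^^ i) \<one> x)) x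
      \<le> (A ^^ (n - i)) (\<lambda>x. supnorm ((A ^^ i) \<one>) * C ^ k) x"
    proof (rule poslin_mono[OF positive_linear_op_poslin[OF P]])
      have c1: "(\<lambda>x. exp (T k x) * (A ^^ i) \<one> x) \<in> CX"
        by (intro CX_intros T_CX positive_linear_op_CX[OF P])
      show "(A ^^ (n * k)) (\<lambda>x. exp (T k x) * (A ^^ i) \<one> x) \<in> CX"
        by (rule positive_linear_op_CX[OF P c1])
      show "(\<lambda>x. supnorm ((A ^^ i) \<one>) * C ^ k) \<in> CX" by (rule CX_const)
      fix y
      have "(A ^^ (n * k)) (\<lambda>x. exp (T k x) * (A ^^ i) \<one> x) y
        \<le> (A ^^ (n * k)) (\<lambda>x. supnorm ((A ^^ i) \<one>) * exp (T k x)) y"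
      proof (rule poslin_mono[OF positive_linear_op_poslin[OF P] c1])
        show "(\<lambda>x. supnorm ((A ^^ i) \<one>) * exp (T k x)) \<in> CX" by (intro CX_intros T_CX)
        show "exp (T k x) * (A ^^ i) \<one> x \<le> supnorm ((A ^^ i) \<one>) * exp (T k x)" for x
          using S[of i x] by (simp add: mult.commute)
      qed
      also have "\<dots> = supnorm ((A ^^ i) \<one>) * (A ^^ (n * k)) (\<lambda>x. exp (T k x)) y"
        by (rule poslin_scale[OF positive_linear_op_poslin[OF P] CX_exp[OF T_CX]])
      also have "\<dots> \<le> supnorm ((A ^^ i) \<one>) * C ^ k"
        by (rule mult_left_mono[OF AT S0])
      finally show "(A ^^ (n * k)) (\<lambda>x. exp (T k x) * (A ^^ i) \<one> x) y \<le> supnorm ((A ^^ i) \<one>) * C ^ k" .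
    qed
    also have "\<dots> = (supnorm ((A ^^ i) \<one>) * C ^ k) * (A ^^ (n - i)) \<one> x"
      by (rule poslin_const[OF positive_linear_op_poslin[OF P]])
    also have "\<dots> \<le> (supnorm ((A ^^ i) \<one>) * C ^ k) * supnorm ((A ^^ (n - i)) \<one>)"
      using C S0 by (intro mult_left_mono S) simp
    finally show ?thesis by (simp add: mult_ac)
  qed
  have growth: "supnorm ((Aphi A \<psi> ^^ (n * Suc k)) \<one>) \<le> K * C ^ k" for k
  proof (rule supnorm_le)
    fix x
    let ?N = "n * Suc k"
    have e: "(\<lambda>x. exp (T k ((\<alpha> ^^ i) x))) \<in> CX" for i by (rule CX_exp[OF Tcomp_CX])
    have "(Aphi A \<psi> ^^ ?N) \<one> x = (A ^^ ?N) (\<lambda>x. exp (birkhoff_sum \<alpha> ?N \<psi> x)) x"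
      by (simp only: Aphi_funpow_one[OF tr cont \<psi>])
    also have "\<dots> \<le> (A ^^ ?N) (\<lambda>x. exp (real n * s) * (\<Sum>i<n. exp (T k ((\<alpha> ^^ i) x)))) x"
      by (rule poslin_mono[OF positive_linear_op_poslin[OF P] _ _ exp_le])
         (intro CX_intros CX_birkhoff_sum cont \<psi> CX_sum Tcomp_CX)+
    also have "\<dots> = exp (real n * s) * (\<Sum>i<n. (A ^^ ?N) (\<lambda>x. exp (T k ((\<alpha> ^^ i) x))) x)"
      by (simp only: poslin_scale[OF positive_linear_op_poslin[OF P] CX_sum[OF e]]
          poslin_sum[OF positive_linear_op_poslin[OF P] finite_lessThan e])
    also have "\<dots> \<le> exp (real n * s) * (\<Sum>i<n. (supnorm ((A ^^ i) \<one>) * supnorm ((A ^^ (n - i)) \<one>)) * C ^ k)"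
      by (intro mult_left_mono sum_mono term_le) auto
    also have "\<dots> = K * C ^ k"
      by (simp add: K_def sum_distrib_right mult.assoc)
    finally show "\<bar>(Aphi A \<psi> ^^ ?N) \<one> x\<bar> \<le> K * C ^ k"
      using positive_linear_op_one_nonneg[OF positive_linear_op_funpow[OF positive_linear_op_Aphi[OF pos \<psi>]], of ?N x]
      by (simp only: abs_of_nonneg)
  qed
  show ?thesis
  proof (rule ccontr)
    assume "\<not> ?thesis"
    then obtain c where c: "ereal (ln C / real n) < ereal c" "ereal c < spec_lambda A \<psi>"
      using ereal_dense2[of "ereal (ln C / real n)" "spec_lambda A \<psi>"] unfolding not_le by blast
    have d: "0 < c * real n - ln C" using c(1) n by (simp add: field_simps)
    have K0: "0 \<le> K" unfolding K_def by (intro mult_nonneg_nonneg sum_nonneg S0) simp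
    \<comment> \<open>For this \<open>k\<close> the bound \<open>K * C ^ k\<close> lies below
      \<open>exp (c * real (n * Suc k))\<close>; the logarithm is taken of \<open>K + 1\<close>
      because \<open>K\<close> can be 0.\<close>
    obtain k where k: "(ln (K + 1) - c * real n) / (c * real n - ln C) \<le> real k"
      using real_arch_simple by blast
    let ?N = "n * Suc k"
    have "ln (K + 1) + real k * ln C \<le> c * real ?N"
      using k d by (simp add: field_simps)
    then have "exp (ln (K + 1) + real k * ln C) \<le> exp (c * real ?N)"
      by (simp only: exp_le_cancel_iff)
    then have "(K + 1) * C ^ k \<le> exp (c * real ?N)"
      using K0 C by (simp add: exp_add exp_of_nat_mult)
    moreover have "K * C ^ k \<le> (K + 1) * C ^ k" using C by simp
    ultimately have "supnorm ((Aphi A \<psi> ^^ ?N) \<one>) \<le> exp (c * real ?N)"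
      using growth[of k] by linarith
    then have "eln (supnorm ((Aphi A \<psi> ^^ ?N) \<one>)) / ereal (real ?N) \<le> ereal c"
      using n by (subst eln_divide_le_iff) auto
    moreover have "spec_lambda A \<psi> \<le> eln (supnorm ((Aphi A \<psi> ^^ ?N) \<one>)) / ereal (real ?N)"
      unfolding spec_lambda_eq_INF[OF comp pos \<psi>] using n by (intro INF_lower) auto
    ultimately show False using c(2) by (metis leD order_trans)
  qed
qed

subsection \<open>The upper bound\<close>

text \<open>
  A partition of unity is a set, so repeated members of a family have to be merged: two copies of \<open>h\<close>
  are replaced by \<open>2h\<close>, which may again collide with a member, but the cardinality drops.
\<close>

lemma add_to_set_sum:
  fixes h :: "'a \<Rightarrow> real"
  assumes dbl: "\<And>g. P g \<Longrightarrow> P (\<lambda>x. g x + g x)"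
    and "finite D" "\<forall>g\<in>D. P g" "P h"
  shows "\<exists>D'. finite D' \<and> (\<forall>g\<in>D'. P g) \<and> (\<forall>x. (\<Sum>g\<in>D'. g x) = (\<Sum>g\<in>D. g x) + h x)"
  using assms(2-)
proof (induction "card D" arbitrary: D h rule: less_induct)
  case less
  show ?case
  proof (cases "h \<in> D")
    case False
    then show ?thesis
      using less.prems by (intro exI[of _ "insert h D"]) auto
  next
    case True
    let ?E = "D - {h}" and ?h2 = "\<lambda>x. h x + h x"
    have "card ?E < card D" using True less.prems(1) by (rule card_Diff1_less[rotated])
    moreover have "P ?h2" by (rule dbl[OF less.prems(3)])
    ultimately obtain D' where D': "finite D'" "\<forall>g\<in>D'. P g"
        "\<forall>x. (\<Sum>g\<in>D'. g x) = (\<Sum>g\<in>?E. g x) + (h x + h x)"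
      using less.hyps[of ?E ?h2] less.prems by auto
    have "(\<Sum>g\<in>?E. g x) + h x = (\<Sum>g\<in>D. g x)" for x
      using True less.prems(1) by (simp add: sum.remove add.commute)
    then have "\<forall>x. (\<Sum>g\<in>D'. g x) = (\<Sum>g\<in>D. g x) + h x"
      using D'(3) by (metis add.assoc)
    then show ?thesis using D' by blast
  qed
qed

lemma family_to_set_sum:
  fixes g :: "'i \<Rightarrow> 'a \<Rightarrow> real"
  assumes dbl: "\<And>g. P g \<Longrightarrow> P (\<lambda>x. g x + g x)"
    and "finite I" "\<And>i. i \<in> I \<Longrightarrow> P (g i)"
  shows "\<exists>D. finite D \<and> (\<forall>g\<in>D. P g) \<and> (\<forall>x. (\<Sum>g\<in>D. g x) = (\<Sum>i\<in>I. g i x))"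
  using assms(2,3)
proof (induction I)
  case empty
  show ?case by (intro exI[of _ "{}"]) simp
next
  case (insert i I)
  then obtain D where D: "finite D" "\<forall>g\<in>D. P g" "\<forall>x. (\<Sum>g\<in>D. g x) = (\<Sum>i\<in>I. g i x)" by auto
  have "P (g i)" using insert.prems by simp
  from add_to_set_sum[of P D "g i", OF dbl D(1,2) this]
  show ?case using D(3) insert.hyps by (simp add: add.commute)
qed

text \<open>The members are tent functions of width 2 in the rescaled values of \<open>f\<close>:
  each lives where \<open>f\<close> is within \<open>e\<close> of a centre, and their sum
  telescopes. Doubling does not change where a function vanishes, so equal members can be
  merged.\<close>

lemma fine_partition_of_unity:
  fixes f :: "'a::topological_space \<Rightarrow> real"
  assumes "compact (UNIV :: 'a set)" "f \<in> CX" "0 < e"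
  obtains D where "D \<in> partitions_of_unity"
    "\<And>g. g \<in> D \<Longrightarrow> \<exists>c. \<forall>x. g x \<noteq> 0 \<longrightarrow> \<bar>f x - c\<bar> \<le> e"
proof -
  define s where "s = supnorm f"
  define cl :: "real \<Rightarrow> real" where "cl t = min 1 (max 0 t)" for t
  \<comment> \<open>The shift makes \<open>y x \<ge> 1\<close>, so the first clamped value in the
    telescoping sum is 1.\<close>
  define y where "y x = (f x + s) / e + 1" for x
  define G where "G i x = cl (y x - real i) - cl (y x - real (Suc i))" for i x
  define P where "P g \<longleftrightarrow> g \<in> CX \<and> (\<forall>x. 0 \<le> g x) \<and> (\<exists>c. \<forall>x. g x \<noteq> 0 \<longrightarrow> \<bar>f x - c\<bar> \<le> e)"
    for g :: "'a \<Rightarrow> real"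
  have fs: "- s \<le> f x" "f x \<le> s" for x
    using abs_le_supnorm[OF assms(1,2), of x] by (auto simp: s_def)
  obtain M where M: "2 * s / e + 1 \<le> real M" using real_arch_simple by blast
  have dbl: "P (\<lambda>x. g x + g x)" if "P g" for g
    using that CX_add[of g g] unfolding P_def by auto
  have PG: "P (G i)" for i
    unfolding P_def
  proof (intro conjI allI exI impI)
    show "G i \<in> CX"
      using assms(2) assms(3) unfolding CX_def G_def[abs_def] cl_def y_def by (auto intro!: continuous_intros)
    show "0 \<le> G i x" for x by (simp add: G_def cl_def)
    fix x assume "G i x \<noteq> 0"
    then have "real i < y x" "y x < real i + 2"
      by (auto simp: G_def cl_def min_def max_def split: if_splits)
    then show "\<bar>f x - (real i * e - s)\<bar> \<le> e"
      using assms(3) by (simp add: y_def field_simps abs_le_iff)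
  qed
  have sumG: "(\<Sum>i<M. G i x) = 1" for x
  proof -
    have "(\<Sum>i<M. G i x) = cl (y x - real 0) - cl (y x - real M)"
      unfolding G_def by (rule sum_lessThan_telescope')
    moreover have "1 \<le> y x" using fs(1)[of x] assms(3) by (simp add: y_def)
    moreover have "y x \<le> real M"
    proof -
      have "y x \<le> 2 * s / e + 1"
        using fs(2)[of x] assms(3) by (simp add: y_def divide_right_mono)
      then show ?thesis using M by simp
    qed
    ultimately show ?thesis by (simp add: cl_def)
  qed
  have "\<exists>D. finite D \<and> (\<forall>g\<in>D. P g) \<and> (\<forall>x. (\<Sum>g\<in>D. g x) = (\<Sum>i<M. G i x))"
    by (rule family_to_set_sum[of P "{..<M}" G, OF dbl finite_lessThan PG])
  then obtain D where D: "finite D" "\<forall>g\<in>D. P g" "\<forall>x. (\<Sum>g\<in>D. g x) = 1"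
    using sumG by auto
  show thesis
  proof
    show "D \<in> partitions_of_unity"
      using D unfolding partitions_of_unity_def P_def one_fun_def by blast
    show "\<exists>c. \<forall>x. g x \<noteq> 0 \<longrightarrow> \<bar>f x - c\<bar> \<le> e" if "g \<in> D" for g
      using D(2) that unfolding P_def by blast
  qed
qed

section \<open>Splitting functionals along a partition of unity\<close>

lemma partition_poslin_sum:
  assumes "D \<in> partitions_of_unity" "poslin m" "f \<in> CX"
  shows "(\<Sum>g\<in>D. m (\<lambda>x. f x * g x)) = m f"
proof -
  have D: "finite D" "\<And>g. g \<in> D \<Longrightarrow> g \<in> CX" "\<And>x. (\<Sum>g\<in>D. g x) = 1"
    using assms(1) by (auto simp: partitions_of_unity_def one_fun_def fun_eq_iff)
  have "(\<Sum>g\<in>D. m (\<lambda>x. f x * g x)) = m (\<lambda>x. \<Sum>g\<in>D. f x * g x)"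
    by (rule poslin_sum[OF assms(2) D(1), symmetric]) (intro CX_mult assms D)
  also have "(\<lambda>x. \<Sum>g\<in>D. f x * g x) = f"
    using D(3) by (simp add: sum_distrib_left[symmetric])
  finally show ?thesis .
qed

lemma partition_MC_sum:
  assumes "D \<in> partitions_of_unity" "\<mu> \<in> MC"
  shows "(\<Sum>g\<in>D. \<mu> g) = 1"
  using partition_poslin_sum[of D \<mu> \<one>] assms CX_one by (simp add: MC_iff one_fun_apply)

lemma exp_weighted_sum_le:
  fixes a y :: "'i \<Rightarrow> real"
  assumes "finite S" "sum a S = 1" "\<And>i. i \<in> S \<Longrightarrow> 0 \<le> a i"
  shows "exp (\<Sum>i\<in>S. a i * y i) \<le> (\<Sum>i\<in>S. a i * exp (y i))"
  using convex_on_sum[of S UNIV exp a y] assms exp_convex by force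

text \<open>On a fine partition \<open>f\<close> differs from \<open>c g\<close> by at most
  \<open>e\<close> where \<open>g\<close> does not vanish. The error \<open>2 * e\<close> arises
  because \<open>c g + e\<close> bounds \<open>f\<close> from above under \<open>\<mu>\<close>,
  while \<open>c g - e\<close> bounds it from below in the exponential.\<close>

lemma tau_n_le:
  fixes A :: "('a::topological_space \<Rightarrow> real) \<Rightarrow> ('a \<Rightarrow> real)"
  assumes comp: "compact (UNIV :: 'a set)" and pos: "positive_linear_op A"
    and \<mu>: "\<mu> \<in> MC" and f: "f \<in> CX" and e: "0 < e"
  shows "tau_n A n \<mu> \<le> eln (supnorm ((A ^^ n) (\<lambda>x. exp (f x)))) + ereal (2 * e - \<mu> f)"
proof -
  define B where "B = A ^^ n"
  have B: "positive_linear_op B" unfolding B_def by (rule positive_linear_op_funpow[OF pos])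
  define L where "L = supnorm (B (\<lambda>x. exp (f x)))"
  have \<mu>pl: "poslin \<mu>" using \<mu> by (simp add: MC_iff)
  obtain D where D: "D \<in> partitions_of_unity"
    and osc: "\<And>g. g \<in> D \<Longrightarrow> \<exists>c. \<forall>x. g x \<noteq> 0 \<longrightarrow> \<bar>f x - c\<bar> \<le> e"
    using fine_partition_of_unity[OF comp f e] by blast
  obtain c where c: "\<And>g x. g \<in> D \<Longrightarrow> g x \<noteq> 0 \<Longrightarrow> \<bar>f x - c g\<bar> \<le> e"
    using osc by metis
  have fin: "finite D" and DC: "\<And>g. g \<in> D \<Longrightarrow> g \<in> CX" and D0: "\<And>g x. g \<in> D \<Longrightarrow> 0 \<le> g x"
    using D by (auto simp: partitions_of_unity_def)
  let ?D = "{g \<in> D. \<mu> g \<noteq> 0}"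
  have \<mu>0: "0 \<le> \<mu> g" if "g \<in> D" for g
    by (rule poslin_nonneg[OF \<mu>pl DC D0]) (use that in auto)
  have sum1: "sum \<mu> ?D = 1"
    using partition_MC_sum[OF D \<mu>] fin by (subst sum.mono_neutral_left[of D]) auto
  have lower: "(c g - e) * g x \<le> f x * g x" and upper: "f x * g x \<le> (c g + e) * g x"
    if "g \<in> D" for g x
    using c[OF that, of x] D0[OF that, of x]
    by (cases "g x = 0"; auto intro!: mult_right_mono simp: abs_le_iff)+
  have \<mu>f: "\<mu> f - 2 * e \<le> (\<Sum>g\<in>?D. \<mu> g * (c g - e))"
  proof -
    have "\<mu> f = (\<Sum>g\<in>D. \<mu> (\<lambda>x. f x * g x))"
      by (rule partition_poslin_sum[OF D \<mu>pl f, symmetric])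
    also have "\<dots> \<le> (\<Sum>g\<in>D. \<mu> (\<lambda>x. (c g + e) * g x))"
      by (intro sum_mono poslin_mono[OF \<mu>pl] upper CX_intros f DC)
    also have "\<dots> = (\<Sum>g\<in>D. (c g + e) * \<mu> g)"
      by (intro sum.cong refl poslin_scale[OF \<mu>pl] DC)
    also have "\<dots> = (\<Sum>g\<in>?D. (c g + e) * \<mu> g)"
      using fin by (intro sum.mono_neutral_right) auto
    also have "\<dots> = (\<Sum>g\<in>?D. \<mu> g * (c g - e)) + 2 * e * sum \<mu> ?D"
      unfolding sum_distrib_left sum.distrib[symmetric] by (rule sum.cong) (auto simp: algebra_simps)
    finally show ?thesis using sum1 by simp
  qed
  have main: "(\<Sum>g\<in>?D. ereal (\<mu> g) * eln (m (B g) / \<mu> g)) \<le> eln L + ereal (2 * e - \<mu> f)"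
    if m: "m \<in> MC" for m
  proof -
    define m' where "m' g = m (B g)" for g
    have mpl: "poslin m" "m \<one> = 1" using m by (auto simp: MC_iff)
    have m'pl: "poslin m'" unfolding m'_def[abs_def] by (rule poslin_compose[OF mpl(1) B])
    have m'0: "0 \<le> m' g" if "g \<in> D" for g
      by (rule poslin_nonneg[OF m'pl DC D0]) (use that in auto)
    show ?thesis
    proof (cases "\<forall>g\<in>?D. 0 < m' g")
      \<comment> \<open>One summand is \<open>-\<infinity>\<close>; as \<open>\<infinity>\<close>
        would win in a sum of extended reals, that value has to be excluded for the others.\<close>
      case False
      then obtain h where h: "h \<in> D" "\<mu> h \<noteq> 0" "m' h \<le> 0" by auto
      let ?t = "\<lambda>g. ereal (\<mu> g) * eln (m (B g) / \<mu> g)"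
      have "0 < \<mu> h" using \<mu>0[OF h(1)] h(2) by simp
      then have "?t h = -\<infinity>"
        using h(3) by (simp add: eln_def m'_def[symmetric] zero_less_divide_iff)
      moreover have "?t g \<noteq> \<infinity>" if "g \<in> ?D" for g
        using \<mu>0[of g] that by (auto simp: eln_def)
      ultimately have "(\<Sum>g\<in>?D. ?t g) \<noteq> \<infinity>" "\<bar>\<Sum>g\<in>?D. ?t g\<bar> = \<infinity>"
        unfolding sum_Pinfty sum_Inf using h fin by auto
      then have "(\<Sum>g\<in>?D. ?t g) = -\<infinity>" by auto
      then show ?thesis by simp
    next
      case True
      have \<mu>p: "0 < \<mu> g" if "g \<in> ?D" for g using \<mu>0[of g] that by auto
      let ?s = "\<Sum>g\<in>?D. \<mu> g * ln (m' g / \<mu> g)"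
      \<comment> \<open>Jensen's inequality with weights \<open>\<mu> g\<close>; these then cancel
        against the denominators under the logarithm.\<close>
      have "exp (\<mu> f - 2 * e + ?s) \<le> exp (\<Sum>g\<in>?D. \<mu> g * ((c g - e) + ln (m' g / \<mu> g)))"
        using \<mu>f by (simp add: distrib_left sum.distrib)
      also have "\<dots> \<le> (\<Sum>g\<in>?D. \<mu> g * exp ((c g - e) + ln (m' g / \<mu> g)))"
        using fin sum1 \<mu>0 by (intro exp_weighted_sum_le) auto
      also have "\<dots> = (\<Sum>g\<in>?D. exp (c g - e) * m' g)"
      proof (rule sum.cong[OF refl])
        fix g assume "g \<in> ?D"
        then have "0 < m' g" "0 < \<mu> g" using True \<mu>p by auto
        then show "\<mu> g * exp ((c g - e) + ln (m' g / \<mu> g)) = exp (c g - e) * m' g"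
          by (simp add: exp_add)
      qed
      also have "\<dots> \<le> (\<Sum>g\<in>D. exp (c g - e) * m' g)"
        using fin m'0 by (intro sum_mono2) auto
      also have "\<dots> = (\<Sum>g\<in>D. m' (\<lambda>x. exp (c g - e) * g x))"
        by (intro sum.cong refl poslin_scale[OF m'pl, symmetric] DC)
      also have "\<dots> \<le> (\<Sum>g\<in>D. m' (\<lambda>x. exp (f x) * g x))"
      proof (intro sum_mono poslin_mono[OF m'pl] CX_intros f DC)
        fix g x assume g: "g \<in> D"
        show "exp (c g - e) * g x \<le> exp (f x) * g x"
          using c[OF g, of x] D0[OF g, of x]
          by (cases "g x = 0"; auto intro!: mult_right_mono simp: abs_le_iff)
      qed
      also have "\<dots> = m' (\<lambda>x. exp (f x))"
        by (rule partition_poslin_sum[OF D m'pl CX_exp[OF f]])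
      also have "\<dots> \<le> L"
        using poslin_le_supnorm[OF comp mpl(1) positive_linear_op_CX[OF B CX_exp[OF f]]] mpl(2)
        unfolding m'_def L_def by simp
      finally have L: "exp (\<mu> f - 2 * e + ?s) \<le> L" .
      then have Lp: "0 < L" using exp_gt_zero less_le_trans by blast
      have "\<mu> f - 2 * e + ?s \<le> ln L" using L Lp by (simp add: ln_ge_iff)
      moreover have "(\<Sum>g\<in>?D. ereal (\<mu> g) * eln (m (B g) / \<mu> g)) = ereal ?s"
      proof -
        have "(\<Sum>g\<in>?D. ereal (\<mu> g) * eln (m (B g) / \<mu> g)) = (\<Sum>g\<in>?D. ereal (\<mu> g * ln (m' g / \<mu> g)))"
          using True \<mu>p by (intro sum.cong refl) (simp add: eln_def m'_def)
        then show ?thesis by simp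
      qed
      ultimately show ?thesis using Lp by (simp add: eln_def)
    qed
  qed
  have "tau_n A n \<mu> \<le> tau_nD A n \<mu> D"
    unfolding tau_n_def by (rule INF_lower[OF D])
  also have "\<dots> \<le> eln L + ereal (2 * e - \<mu> f)"
    unfolding tau_nD_def B_def[symmetric] by (rule SUP_least[OF main])
  finally show ?thesis unfolding L_def B_def .
qed

lemma Mdelta_birkhoff_sum:
  assumes "\<mu> \<in> Mdelta \<alpha>" "continuous_on UNIV \<alpha>" "f \<in> CX"
  shows "\<mu> (birkhoff_sum \<alpha> n f) = real n * \<mu> f"
proof -
  have \<mu>: "poslin \<mu>" "\<And>f. f \<in> CX \<Longrightarrow> \<mu> (delta \<alpha> f) = \<mu> f"
    using assms(1) by (auto simp: Mdelta_def MC_iff)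
  have "\<mu> (\<lambda>x. f ((\<alpha> ^^ i) x)) = \<mu> f" for i
  proof (induction i)
    case (Suc i)
    have "\<mu> (delta \<alpha> (\<lambda>x. f ((\<alpha> ^^ i) x))) = \<mu> (\<lambda>x. f ((\<alpha> ^^ i) x))"
      by (rule \<mu>(2)[OF CX_comp[OF assms(3) continuous_on_funpow[OF assms(2)]]])
    then show ?case
      unfolding delta_def o_def funpow_Suc_right by (simp add: Suc)
  qed simp
  moreover have "\<mu> (\<lambda>x. \<Sum>i<n. f ((\<alpha> ^^ i) x)) = (\<Sum>i<n. \<mu> (\<lambda>x. f ((\<alpha> ^^ i) x)))"
    by (rule poslin_sum[OF \<mu>(1) finite_lessThan CX_comp[OF assms(3) continuous_on_funpow[OF assms(2)]]])
  ultimately show ?thesis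
    by (simp add: birkhoff_sum_def[abs_def])
qed

text \<open>Each \<open>n\<close> is compared with the term of index \<open>n\<close> in the infimum
  formula: \<open>tau_n_le\<close> is applied to the Birkhoff sum of \<open>\<phi>\<close>, on which
  an invariant \<open>\<mu>\<close> takes the value \<open>real n * \<mu> \<phi>\<close>.\<close>

lemma t_entropy_le_spec_lambda:
  fixes A :: "('a::topological_space \<Rightarrow> real) \<Rightarrow> ('a \<Rightarrow> real)"
  assumes comp: "compact (UNIV :: 'a set)" and cont: "continuous_on UNIV \<alpha>"
    and tr: "transfer_operator \<alpha> A" and \<phi>: "\<phi> \<in> CX" and \<mu>: "\<mu> \<in> Mdelta \<alpha>"
  shows "t_entropy A \<mu> + ereal (\<mu> \<phi>) \<le> spec_lambda A \<phi>"
proof -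
  have pos: "positive_linear_op A" using tr unfolding transfer_operator_def by blast
  have \<mu>M: "\<mu> \<in> MC" using \<mu> by (simp add: Mdelta_def)
  have "t_entropy A \<mu> + ereal (\<mu> \<phi>) \<le> eln (supnorm ((Aphi A \<phi> ^^ n) \<one>)) / ereal (real n)"
    if n: "n \<in> {1..}" for n
  proof -
    let ?L = "supnorm ((Aphi A \<phi> ^^ n) \<one>)"
    have n0: "0 < n" using n by simp
    have t1: "t_entropy A \<mu> \<le> tau_n A n \<mu> / ereal (real n)"
      unfolding t_entropy_def by (rule INF_lower[OF n])
    have t2: "tau_n A n \<mu> \<le> eln ?L + ereal (2 * e - real n * \<mu> \<phi>)" if "0 < e" for e
      using tau_n_le[OF comp pos \<mu>M CX_birkhoff_sum[OF cont \<phi>] that, of n n]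
      unfolding Aphi_funpow_one[OF tr cont \<phi>] Mdelta_birkhoff_sum[OF \<mu> cont \<phi>] .
    show ?thesis
    proof (cases "0 < ?L")
      case False
      then have "tau_n A n \<mu> = -\<infinity>" using t2[of 1] by (simp add: eln_def)
      then show ?thesis using t1 n0 by (simp add: divide_ereal_def)
    next
      case True
      have "t_entropy A \<mu> + ereal (\<mu> \<phi>) \<le> ereal (ln ?L / real n) + ereal e" if e: "0 < e" for e
      proof -
        \<comment> \<open>The oscillation \<open>real n * e / 2\<close> leaves the error
          \<open>e\<close> after doubling and division by \<open>n\<close>.\<close>
        have e': "0 < real n * e / 2" using e n0 by simp
        have "t_entropy A \<mu> \<le> tau_n A n \<mu> / ereal (real n)" by (rule t1)
        also have "\<dots> \<le> ereal (ln ?L + (2 * (real n * e / 2) - real n * \<mu> \<phi>)) / ereal (real n)"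
          using t2[OF e'] True n0 by (intro ereal_divide_right_mono) (simp_all add: eln_def)
        also have "\<dots> = ereal (ln ?L / real n + e - \<mu> \<phi>)"
          using n0 by (simp add: field_simps)
        finally show ?thesis by (cases "t_entropy A \<mu>") auto
      qed
      then have "t_entropy A \<mu> + ereal (\<mu> \<phi>) \<le> ereal (ln ?L / real n)"
        by (rule ereal_le_epsilon2)
      then show ?thesis using True n0 by (simp add: eln_def)
    qed
  qed
  then show ?thesis
    unfolding spec_lambda_eq_INF[OF comp pos \<phi>] by (rule INF_greatest)
qed

subsection \<open>Weak-star cluster points and the tangent functional\<close>

text \<open>
  Members of \<open>MC\<close> are arbitrary off \<open>CX\<close>; normalising them to \<open>0\<close> there makes the set compact in the
  product topology.
\<close>

definition MC0 :: "(('a::topological_space \<Rightarrow> real) \<Rightarrow> real) set" where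
  "MC0 = {m \<in> MC. \<forall>f. f \<notin> CX \<longrightarrow> m f = 0}"

definition vanish_off_CX :: "(('a::topological_space \<Rightarrow> real) \<Rightarrow> real) \<Rightarrow> (('a \<Rightarrow> real) \<Rightarrow> real)" where
  "vanish_off_CX m f = (if f \<in> CX then m f else 0)"

lemma vanish_off_CX_apply: "f \<in> CX \<Longrightarrow> vanish_off_CX m f = m f"
  by (simp add: vanish_off_CX_def)

lemma vanish_off_CX_in_MC0:
  fixes m :: "('a::topological_space \<Rightarrow> real) \<Rightarrow> real"
  assumes "m \<in> MC"
  shows "vanish_off_CX m \<in> MC0"
proof -
  have m: "poslin m" "m \<one> = 1" using assms by (auto simp: MC_iff)
  have "poslin (vanish_off_CX m)"
    unfolding poslin_def
  proof (intro conjI ballI allI impI)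
    fix f g :: "'a \<Rightarrow> real" and c :: real
    assume f: "f \<in> CX"
    show "vanish_off_CX m (\<lambda>x. c * f x) = c * vanish_off_CX m f"
      by (simp only: vanish_off_CX_apply[OF f] vanish_off_CX_apply[OF CX_mult[OF CX_const f]]
          poslin_scale[OF m(1) f])
    show "0 \<le> vanish_off_CX m f" if "\<forall>x. 0 \<le> f x"
      using poslin_nonneg[OF m(1) f] that by (simp only: vanish_off_CX_apply[OF f])
    assume g: "g \<in> CX"
    show "vanish_off_CX m (\<lambda>x. f x + g x) = vanish_off_CX m f + vanish_off_CX m g"
      by (simp only: vanish_off_CX_apply[OF f] vanish_off_CX_apply[OF g] vanish_off_CX_apply[OF CX_add[OF f g]]
          poslin_add[OF m(1) f g])
  qed
  then show ?thesis
    using m(2) by (simp add: MC0_def MC_iff vanish_off_CX_def CX_one)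
qed

text \<open>Banach-Alaoglu through Tychonoff: \<open>MC0\<close> lies in a product of compact
  intervals, and each defining condition is closed because it involves only finitely many
  coordinates.\<close>

lemma compact_MC0:
  assumes "compact (UNIV :: 'a::topological_space set)"
  shows "compact (MC0 :: (('a \<Rightarrow> real) \<Rightarrow> real) set)"
proof -
  define S where "S f = (if f \<in> CX then {- supnorm f..supnorm f} else {0})" for f :: "'a \<Rightarrow> real"
  have "compactin (product_topology (\<lambda>_. euclidean) UNIV) (PiE UNIV S)"
    unfolding compactin_PiE by (auto simp: S_def)
  then have "compact (PiE UNIV S)"
    by (simp add: euclidean_product_topology)
  moreover have "closed (MC0 :: (('a \<Rightarrow> real) \<Rightarrow> real) set)"
    unfolding MC0_def MC_def Ball_def mem_Collect_eq
    by (intro closed_Collect_conj closed_Collect_all closed_Collect_imp open_Collect_const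
        closed_Collect_eq closed_Collect_le continuous_on_add continuous_on_mult continuous_on_const
        continuous_on_product_coordinates)
  moreover have "MC0 \<subseteq> PiE UNIV S"
  proof
    fix m :: "('a \<Rightarrow> real) \<Rightarrow> real" assume "m \<in> MC0"
    then have m: "poslin m" "m \<one> = 1" "\<forall>f. f \<notin> CX \<longrightarrow> m f = 0"
      by (auto simp: MC0_def MC_iff)
    have "m f \<in> S f" for f
      using m(3) poslin_le_supnorm[OF assms m(1), of f] m(2) by (auto simp: S_def abs_le_iff)
    then show "m \<in> PiE UNIV S" by auto
  qed
  ultimately show ?thesis
    using compact_Int_closed by (metis inf.absorb_iff2)
qed

text \<open>The product topology need not be metrisable, so instead of a limit of a subsequence a
  point in the closure of every tail is taken, by the finite intersection property.\<close>

lemma MC0_cluster_point: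
  fixes \<nu> :: "nat \<Rightarrow> ('a::topological_space \<Rightarrow> real) \<Rightarrow> real"
  assumes "compact (UNIV :: 'a set)" "\<And>n. \<nu> n \<in> MC0"
  obtains \<mu> where "\<mu> \<in> MC0"
    "\<forall>h :: (('a \<Rightarrow> real) \<Rightarrow> real) \<Rightarrow> real. \<forall>e N. continuous_on UNIV h \<longrightarrow> 0 < e \<longrightarrow> (\<exists>n\<ge>N. \<bar>h (\<nu> n) - h \<mu>\<bar> < e)"
proof -
  have "MC0 \<inter> (\<Inter>N. closure (\<nu> ` {N..})) \<noteq> {}"
  proof (rule compact_imp_fip_image[OF compact_MC0[OF assms(1)]])
    fix I :: "nat set" assume "finite I"
    then obtain k where k: "\<forall>i\<in>I. i \<le> k" using finite_nat_set_iff_bounded_le by blast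
    have "\<nu> k \<in> closure (\<nu> ` {i..})" if "i \<in> I" for i
      using k that by (intro subsetD[OF closure_subset]) auto
    then show "MC0 \<inter> (\<Inter>i\<in>I. closure (\<nu> ` {i..})) \<noteq> {}" using assms(2)[of k] by blast
  qed simp
  then obtain \<mu> where \<mu>: "\<mu> \<in> MC0" "\<And>N. \<mu> \<in> closure (\<nu> ` {N..})" by blast
  show thesis
  proof (rule that[OF \<mu>(1)], intro allI impI)
    fix h :: "(('a \<Rightarrow> real) \<Rightarrow> real) \<Rightarrow> real" and e :: real and N
    assume h: "continuous_on UNIV h" and e: "0 < e"
    let ?U = "h -` ball (h \<mu>) e"
    have "open ?U" using h by (simp add: open_vimage)
    moreover have "\<mu> \<in> ?U \<inter> closure (\<nu> ` {N..})" using \<mu>(2)[of N] e by simp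
    then have "?U \<inter> closure (\<nu> ` {N..}) \<noteq> {}" by blast
    ultimately have "?U \<inter> \<nu> ` {N..} \<noteq> {}" by (simp add: open_Int_closure_eq_empty)
    then show "\<exists>n\<ge>N. \<bar>h (\<nu> n) - h \<mu>\<bar> < e" by (auto simp: dist_real_def abs_minus_commute)
  qed
qed

text \<open>The Krylov-Bogolyubov argument: the Birkhoff sums of \<open>delta \<alpha> f\<close> and
  \<open>f\<close> differ, by telescoping, by a function of norm at most
  \<open>2 * supnorm f\<close>, which disappears after division by the length.\<close>

lemma Mdelta_cluster_point:
  fixes m :: "nat \<Rightarrow> ('a::topological_space \<Rightarrow> real) \<Rightarrow> real"
  assumes comp: "compact (UNIV :: 'a set)" and cont: "continuous_on UNIV \<alpha>"
    and m: "\<And>n. 0 < n \<Longrightarrow> m n \<in> MC"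
  obtains \<mu> where "\<mu> \<in> Mdelta \<alpha>"
    "\<forall>f\<in>CX. \<forall>e>0. \<forall>N. \<exists>n\<ge>N. 0 < n \<and> \<bar>m n (birkhoff_sum \<alpha> n f) / real n - \<mu> f\<bar> < e"
proof -
  \<comment> \<open>The index is shifted by one since \<open>m 0\<close> is unconstrained and the
    average divides by the length.\<close>
  define \<nu>' where "\<nu>' n f = m (Suc n) (birkhoff_sum \<alpha> (Suc n) f) / real (Suc n)" for n f
  define \<nu> where "\<nu> n = vanish_off_CX (\<nu>' n)" for n
  note bCX = CX_birkhoff_sum[OF cont]
  have mpl: "poslin (m (Suc n))" "m (Suc n) \<one> = 1" for n
    using m[of "Suc n"] by (auto simp: MC_iff)
  have "\<nu>' n \<in> MC" for n
    unfolding MC_iff poslin_def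
  proof (intro conjI ballI allI impI)
    fix f g :: "'a \<Rightarrow> real" and c :: real
    assume f: "f \<in> CX"
    have "birkhoff_sum \<alpha> (Suc n) (\<lambda>x. c * f x) = (\<lambda>x. c * birkhoff_sum \<alpha> (Suc n) f x)"
      by (simp only: birkhoff_sum_def[abs_def] sum_distrib_left)
    then show "\<nu>' n (\<lambda>x. c * f x) = c * \<nu>' n f"
      unfolding \<nu>'_def by (simp only: poslin_scale[OF mpl(1) bCX[OF f]] times_divide_eq_right)
    show "0 \<le> \<nu>' n f" if "\<forall>x. 0 \<le> f x"
      unfolding \<nu>'_def
      by (intro divide_nonneg_nonneg poslin_nonneg[OF mpl(1) bCX[OF f]])
        (simp_all add: birkhoff_sum_def that sum_nonneg)
    assume g: "g \<in> CX"
    have "birkhoff_sum \<alpha> (Suc n) (\<lambda>x. f x + g x)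
      = (\<lambda>x. birkhoff_sum \<alpha> (Suc n) f x + birkhoff_sum \<alpha> (Suc n) g x)"
      by (simp only: birkhoff_sum_def[abs_def] sum.distrib)
    then show "\<nu>' n (\<lambda>x. f x + g x) = \<nu>' n f + \<nu>' n g"
      unfolding \<nu>'_def by (simp only: poslin_add[OF mpl(1) bCX[OF f] bCX[OF g]] add_divide_distrib)
  next
    have "birkhoff_sum \<alpha> (Suc n) \<one> = (\<lambda>x. real (Suc n))"
      by (simp add: birkhoff_sum_def[abs_def] one_fun_apply add.commute)
    then show "\<nu>' n \<one> = 1"
      unfolding \<nu>'_def by (simp only: poslin_const[OF mpl(1)] mpl(2)) simp
  qed
  then have \<nu>_MC0: "\<nu> n \<in> MC0" for n unfolding \<nu>_def by (rule vanish_off_CX_in_MC0)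
  obtain \<mu> where \<mu>: "\<mu> \<in> MC0"
    and cl: "\<forall>h :: (('a \<Rightarrow> real) \<Rightarrow> real) \<Rightarrow> real. \<forall>e N. continuous_on UNIV h \<longrightarrow> 0 < e \<longrightarrow> (\<exists>n\<ge>N. \<bar>h (\<nu> n) - h \<mu>\<bar> < e)"
    by (rule MC0_cluster_point[of \<nu>, OF comp \<nu>_MC0])
  have \<nu>: "\<nu> n f = m (Suc n) (birkhoff_sum \<alpha> (Suc n) f) / real (Suc n)" if "f \<in> CX" for n f
    using that by (simp add: \<nu>_def vanish_off_CX_apply \<nu>'_def)
  have inv: "\<mu> (delta \<alpha> f) = \<mu> f" if f: "f \<in> CX" for f
  proof (rule ccontr)
    assume ne: "\<mu> (delta \<alpha> f) \<noteq> \<mu> f"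
    \<comment> \<open>Half of the supposed defect of invariance: a late average has defect at most
      \<open>e\<close>, yet this is within less than \<open>e\<close> of a defect of size
      \<open>2 * e\<close>.\<close>
    define e where "e = \<bar>\<mu> (delta \<alpha> f) - \<mu> f\<bar> / 2"
    have e: "0 < e" using ne by (simp add: e_def)
    have df: "delta \<alpha> f \<in> CX" using CX_comp[OF f cont] by (simp add: delta_def o_def)
    obtain N where N: "2 * supnorm f / e \<le> real N" using real_arch_simple by blast
    let ?h = "\<lambda>\<nu> :: ('a \<Rightarrow> real) \<Rightarrow> real. \<nu> (delta \<alpha> f) - \<nu> f"
    have "continuous_on UNIV ?h" by (intro continuous_on_diff continuous_on_product_coordinates)
    from cl[rule_format, OF this e, of N] obtain n where n: "n \<ge> N" "\<bar>?h (\<nu> n) - ?h \<mu>\<bar> < e" by blast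
    let ?b = "birkhoff_sum \<alpha> (Suc n)" and ?r = "\<lambda>x. f ((\<alpha> ^^ Suc n) x) - f x"
    have r: "?r \<in> CX" by (intro CX_diff f CX_comp[OF f continuous_on_funpow[OF cont]])
    have "(\<lambda>x. ?b (delta \<alpha> f) x - ?b f x) = ?r"
    proof
      fix x
      have "?b (delta \<alpha> f) x - ?b f x = (\<Sum>i<Suc n. f ((\<alpha> ^^ Suc i) x) - f ((\<alpha> ^^ i) x))"
        by (simp only: birkhoff_sum_def delta_def o_apply funpow.simps sum_subtractf)
      also have "\<dots> = f ((\<alpha> ^^ Suc n) x) - f ((\<alpha> ^^ 0) x)"
        by (rule sum_lessThan_telescope)
      finally show "?b (delta \<alpha> f) x - ?b f x = ?r x" by simp
    qed
    then have h_eq: "?h (\<nu> n) = m (Suc n) ?r / real (Suc n)"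
      using poslin_diff[OF mpl(1) bCX[OF df] bCX[OF f], of n "Suc n" "Suc n"]
      by (simp only: \<nu>[OF df] \<nu>[OF f] diff_divide_distrib)
    have r_le: "\<bar>m (Suc n) ?r\<bar> \<le> 2 * supnorm f"
    proof -
      have "\<bar>m (Suc n) ?r\<bar> \<le> supnorm ?r"
        using poslin_le_supnorm[OF comp mpl(1) r, of n] mpl(2) by simp
      also have "\<dots> \<le> 2 * supnorm f"
      proof (rule supnorm_le)
        show "\<bar>?r x\<bar> \<le> 2 * supnorm f" for x
          using abs_le_supnorm[OF comp f, of "(\<alpha> ^^ Suc n) x"] abs_le_supnorm[OF comp f, of x]
          by linarith
      qed
      finally show ?thesis .
    qed
    have e_ge: "2 * supnorm f / real (Suc n) \<le> e"
    proof -
      have "2 * supnorm f \<le> e * real N" using N e by (simp add: field_simps)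
      also have "\<dots> \<le> e * real (Suc n)" using n(1) e by (intro mult_left_mono) auto
      finally show ?thesis by (simp add: field_simps)
    qed
    have "\<bar>?h (\<nu> n)\<bar> = \<bar>m (Suc n) ?r\<bar> / real (Suc n)"
      by (simp only: h_eq abs_divide abs_of_nat)
    also have "\<dots> \<le> e"
      by (rule order_trans[OF divide_right_mono[OF r_le of_nat_0_le_iff] e_ge])
    finally have "\<bar>?h (\<nu> n)\<bar> \<le> e" .
    moreover have "\<bar>?h \<mu>\<bar> = 2 * e" by (simp add: e_def)
    ultimately show False using n(2) by linarith
  qed
  show thesis
  proof (rule that)
    show "\<mu> \<in> Mdelta \<alpha>" using \<mu> inv by (simp add: Mdelta_def MC0_def)
  next
    show "\<forall>f\<in>CX. \<forall>e>0. \<forall>N. \<exists>n\<ge>N. 0 < n \<and> \<bar>m n (birkhoff_sum \<alpha> n f) / real n - \<mu> f\<bar> < e"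
    proof (intro ballI allI impI)
      fix f :: "'a \<Rightarrow> real" and e :: real and N
      assume f: "f \<in> CX" and "0 < e"
      then obtain n where "n \<ge> N" "\<bar>\<nu> n f - \<mu> f\<bar> < e"
        using cl[rule_format, of "\<lambda>\<nu>. \<nu> f" e N] by (auto simp: continuous_on_product_coordinates)
      then show "\<exists>n\<ge>N. 0 < n \<and> \<bar>m n (birkhoff_sum \<alpha> n f) / real n - \<mu> f\<bar> < e"
        unfolding \<nu>[OF f] by (intro exI[of _ "Suc n"]) simp
    qed
  qed
qed

text \<open>
  The functional is a cluster point of the empirical averages seen from a point where
  \<open>A\<^sub>\<phi>\<^sup>n \<one>\<close> is maximal; Jensen's inequality makes it tangent to \<open>\<lambda>\<close> at \<open>\<phi>\<close>.
\<close>

lemma spec_lambda_tangent: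
  fixes A :: "('a::topological_space \<Rightarrow> real) \<Rightarrow> ('a \<Rightarrow> real)"
  assumes comp: "compact (UNIV :: 'a set)" and cont: "continuous_on UNIV \<alpha>"
    and tr: "transfer_operator \<alpha> A" and \<phi>: "\<phi> \<in> CX" and l: "spec_lambda A \<phi> = ereal l"
  obtains \<mu> where "\<mu> \<in> Mdelta \<alpha>" "\<And>\<psi>. \<psi> \<in> CX \<Longrightarrow> ereal (l + (\<mu> \<psi> - \<mu> \<phi>)) \<le> spec_lambda A \<psi>"
proof -
  have pos: "positive_linear_op A" using tr unfolding transfer_operator_def by blast
  note PF = positive_linear_op_funpow[OF positive_linear_op_Aphi[OF pos \<phi>]]
  define L where "L n = supnorm ((Aphi A \<phi> ^^ n) \<one>)" for n
  \<comment> \<open>The potential is an infimum, so \<open>l\<close> is a lower bound for every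
    \<open>n\<close>; in particular \<open>L n\<close> is positive and may serve as a
    denominator.\<close>
  have L: "exp (l * real n) \<le> L n" if n: "0 < n" for n
  proof -
    have *: "ereal l \<le> eln (L n) / ereal (real n)"
      unfolding l[symmetric] spec_lambda_eq_INF[OF comp pos \<phi>] L_def using n by (intro INF_lower) auto
    have Lp: "0 < L n"
    proof (rule ccontr)
      assume "\<not> 0 < L n"
      then have "eln (L n) / ereal (real n) = -\<infinity>" using n by (simp add: eln_def divide_ereal_def)
      then show False using * by simp
    qed
    then have "l * real n \<le> ln (L n)"
      using * n by (simp add: eln_def field_simps)
    then show ?thesis using Lp by (simp add: ln_ge_iff)
  qed
  have "\<exists>x. L n = (Aphi A \<phi> ^^ n) \<one> x" for n
    using supnorm_attained[OF comp positive_linear_op_CX[OF PF CX_one], of n]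
      positive_linear_op_one_nonneg[OF PF, of n] unfolding L_def by (metis abs_of_nonneg)
  then obtain x where x: "\<And>n. L n = (Aphi A \<phi> ^^ n) \<one> (x n)" by metis
  define m where "m n f = (Aphi A \<phi> ^^ n) f (x n) / L n" for n f
  have Lpos: "0 < L n" if "0 < n" for n using L[OF that] exp_gt_zero less_le_trans by blast
  have m: "m n \<in> MC" if n: "0 < n" for n
  proof -
    note pl = positive_linear_op_poslin[OF PF, of n "x n"]
    have "poslin (m n)"
      unfolding poslin_def m_def
      using poslin_add[OF pl] poslin_scale[OF pl] poslin_nonneg[OF pl] Lpos[OF n]
      by (simp add: add_divide_distrib)
    then show ?thesis using Lpos[OF n] by (simp add: MC_iff m_def x[symmetric])
  qed
  obtain \<mu> where \<mu>: "\<mu> \<in> Mdelta \<alpha>"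
    and cl: "\<forall>f\<in>CX. \<forall>e>0. \<forall>N. \<exists>n\<ge>N. 0 < n \<and> \<bar>m n (birkhoff_sum \<alpha> n f) / real n - \<mu> f\<bar> < e"
    by (rule Mdelta_cluster_point[of \<alpha> m, OF comp cont m])
  have "ereal (l + (\<mu> \<psi> - \<mu> \<phi>)) \<le> spec_lambda A \<psi>" if \<psi>: "\<psi> \<in> CX" for \<psi>
  proof (rule ccontr)
    assume "\<not> ?thesis"
    then obtain c where c: "spec_lambda A \<psi> < ereal c" "ereal c < ereal (l + (\<mu> \<psi> - \<mu> \<phi>))"
      using ereal_dense2 unfolding not_le by blast
    obtain K where K: "1 \<le> K" "\<And>n. supnorm ((Aphi A \<psi> ^^ n) \<one>) \<le> K * exp (c * real n)"
      using spec_lambda_less_imp_growth[OF comp pos \<psi> c(1)] by blast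
    let ?f = "\<lambda>x. \<psi> x - \<phi> x"
    have f: "?f \<in> CX" by (intro CX_diff \<psi> \<phi>)
    have \<mu>f: "\<mu> ?f = \<mu> \<psi> - \<mu> \<phi>"
      using \<mu> \<psi> \<phi> by (intro poslin_diff) (auto simp: Mdelta_def MC_iff)
    \<comment> \<open>Of the gap \<open>2 * e\<close>, one \<open>e\<close> pays for
      \<open>ln K / real n\<close> and the other for the distance of the average from
      \<open>\<mu> ?f\<close>.\<close>
    define e where "e = (l + \<mu> ?f - c) / 2"
    have e: "0 < e" using c(2) by (simp add: e_def \<mu>f)
    obtain N where N: "ln K / e \<le> real N" using real_arch_simple by blast
    obtain n where n: "n \<ge> N" "0 < n" "\<bar>m n (birkhoff_sum \<alpha> n ?f) / real n - \<mu> ?f\<bar> < e"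
      using cl f e by blast
    have "exp (l * real n + m n (birkhoff_sum \<alpha> n ?f)) \<le> exp (ln K + c * real n)"
    proof -
      have bf: "birkhoff_sum \<alpha> n ?f \<in> CX" by (rule CX_birkhoff_sum[OF cont f])
      \<comment> \<open>Jensen's inequality for \<open>m n\<close>; the weights then combine, since
        the Birkhoff sums of \<open>\<phi>\<close> and \<open>\<psi> - \<phi>\<close> add up to that
        of \<open>\<psi>\<close>.\<close>
      have "exp (l * real n + m n (birkhoff_sum \<alpha> n ?f))
        \<le> L n * m n (\<lambda>x. exp (birkhoff_sum \<alpha> n ?f x))"
        unfolding exp_add using Lpos[OF n(2)]
        by (intro mult_mono L[OF n(2)] exp_poslin_le[OF m[OF n(2)] bf]) auto
      also have "\<dots> = (Aphi A \<phi> ^^ n) (\<lambda>x. exp (birkhoff_sum \<alpha> n ?f x)) (x n)"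
        using Lpos[OF n(2)] by (simp add: m_def)
      also have "\<dots> = (Aphi A \<psi> ^^ n) \<one> (x n)"
      proof -
        have "exp (birkhoff_sum \<alpha> n \<phi> x) * exp (birkhoff_sum \<alpha> n ?f x) = exp (birkhoff_sum \<alpha> n \<psi> x)" for x
          by (simp add: birkhoff_sum_def sum_subtractf exp_add[symmetric])
        then show ?thesis
          by (simp only: Aphi_funpow[OF tr cont \<phi> CX_exp[OF bf]] Aphi_funpow_one[OF tr cont \<psi>])
      qed
      also have "\<dots> \<le> supnorm ((Aphi A \<psi> ^^ n) \<one>)"
        by (rule positive_linear_op_one_le_supnorm[OF comp
              positive_linear_op_funpow[OF positive_linear_op_Aphi[OF pos \<psi>]]])
      also have "\<dots> \<le> exp (ln K + c * real n)"
        using K(2)[of n] K(1) by (simp add: exp_add)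
      finally show ?thesis .
    qed
    then have "l * real n + m n (birkhoff_sum \<alpha> n ?f) \<le> ln K + c * real n" by simp
    moreover have "ln K \<le> e * real n"
    proof -
      have "ln K \<le> e * real N" using N e by (simp add: field_simps)
      also have "\<dots> \<le> e * real n" using n(1) e by (intro mult_left_mono) auto
      finally show ?thesis .
    qed
    moreover have "(\<mu> ?f - e) * real n < m n (birkhoff_sum \<alpha> n ?f)"
    proof -
      have "\<mu> ?f - e < m n (birkhoff_sum \<alpha> n ?f) / real n" using n(3) by linarith
      then show ?thesis using n(2) by (simp add: pos_less_divide_eq)
    qed
    ultimately have "(l + \<mu> ?f - 2 * e - c) * real n < 0"
      by (simp add: algebra_simps)
    moreover have "l + \<mu> ?f - 2 * e - c = 0" by (simp add: e_def field_simps)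
    ultimately show False by simp
  qed
  with \<mu> show thesis using that by blast
qed

subsection \<open>The lower bound\<close>

lemma MC0_convex:
  assumes "m0 \<in> MC0" "m1 \<in> MC0" "0 \<le> t" "t \<le> 1"
  shows "(\<lambda>f. (1 - t) * m0 f + t * m1 f) \<in> MC0"
  using assms
  by (auto simp: MC0_def MC_def algebra_simps) (simp add: add_increasing2 mult_left_le_one_le)

text \<open>
  The logarithm is regularised by \<open>\<eta>\<close> so that \<open>F\<close> is continuous on the compact set \<open>MC0\<close>. Non-positivity of
  the one-sided derivatives at its maximum \<open>m0\<close> says that \<open>(A ^^ n)\<close> maps
  \<open>\<Sum>g. (\<mu> g / (m0 ((A ^^ n) g) + \<eta>)) g\<close> below \<open>1\<close>, so this function serves as a weight \<open>e\<^sup>n\<^sup>\<psi>\<close>.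
\<close>

lemma regularised_entropy_bound:
  fixes A :: "('a::topological_space \<Rightarrow> real) \<Rightarrow> ('a \<Rightarrow> real)"
  assumes comp: "compact (UNIV :: 'a set)" and cont: "continuous_on UNIV \<alpha>"
    and tr: "transfer_operator \<alpha> A" and \<mu>: "\<mu> \<in> MC" and n: "0 < n"
    and D: "D \<in> partitions_of_unity" and \<eta>: "0 < \<eta>"
    and S: "\<And>\<psi>. \<psi> \<in> CX \<Longrightarrow> ereal (S + \<mu> \<psi>) \<le> spec_lambda A \<psi>"
  shows "\<exists>m\<in>MC0. real n * S \<le> (\<Sum>g\<in>{g\<in>D. \<mu> g \<noteq> 0}. \<mu> g * ln ((max 0 (m ((A ^^ n) g)) + \<eta>) / \<mu> g))
    + ln (1 + \<eta> * supnorm ((A ^^ n) \<one>))"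
proof -
  define B where "B = A ^^ n"
  define b where "b = supnorm (B \<one>)"
  have pos: "positive_linear_op A" using tr unfolding transfer_operator_def by blast
  have B: "positive_linear_op B" unfolding B_def by (rule positive_linear_op_funpow[OF pos])
  have b0: "0 \<le> b" unfolding b_def by (rule supnorm_one_nonneg[OF comp B])
  have \<mu>pl: "poslin \<mu>" using \<mu> by (simp add: MC_iff)
  have fin: "finite D" and DC: "\<And>g. g \<in> D \<Longrightarrow> g \<in> CX" and D0: "\<And>g x. g \<in> D \<Longrightarrow> 0 \<le> g x"
    and D1: "\<And>x. (\<Sum>g\<in>D. g x) = 1"
    using D by (auto simp: partitions_of_unity_def one_fun_def fun_eq_iff)
  let ?D = "{g \<in> D. \<mu> g \<noteq> 0}"
  have \<mu>0: "0 \<le> \<mu> g" if "g \<in> D" for g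
    by (rule poslin_nonneg[OF \<mu>pl DC D0]) (use that in auto)
  have \<mu>p: "0 < \<mu> g" if "g \<in> ?D" for g using \<mu>0[of g] that by auto
  have sum1: "sum \<mu> ?D = 1"
    using partition_MC_sum[OF D \<mu>] fin by (subst sum.mono_neutral_left[of D]) auto
  \<comment> \<open>Cutting off at 0 keeps the argument of the logarithm positive for all
    \<open>m\<close>, so \<open>F\<close> is continuous everywhere; on \<open>MC0\<close> the values
    \<open>m (B g)\<close> are nonnegative anyway.\<close>
  define F where "F m = (\<Sum>g\<in>?D. \<mu> g * ln ((max 0 (m (B g)) + \<eta>) / \<mu> g))"
    for m :: "('a \<Rightarrow> real) \<Rightarrow> real"
  have "continuous_on UNIV F"
    unfolding F_def[abs_def]
  proof (intro continuous_on_sum continuous_on_mult continuous_on_const continuous_on_ln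
      continuous_on_divide continuous_on_add continuous_on_max continuous_on_product_coordinates ballI)
    fix g and m :: "('a \<Rightarrow> real) \<Rightarrow> real" assume g: "g \<in> ?D"
    show "\<mu> g \<noteq> 0" using g by simp
    have "0 < max 0 (m (B g)) + \<eta>" using \<eta> by (simp add: add_nonneg_pos)
    then show "(max 0 (m (B g)) + \<eta>) / \<mu> g \<noteq> 0" using g by simp
  qed
  moreover have "(MC0 :: (('a \<Rightarrow> real) \<Rightarrow> real) set) \<noteq> {}"
    using vanish_off_CX_in_MC0[OF eval_in_MC] by blast
  ultimately obtain m0 where m0: "m0 \<in> MC0" and max: "\<And>m. m \<in> MC0 \<Longrightarrow> F m \<le> F m0"
    using continuous_attains_sup[OF compact_MC0[OF comp]] continuous_on_subset[of UNIV F MC0]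
    by (metis subset_UNIV)
  define a where "a g = m0 (B g)" for g
  have nonneg: "0 \<le> m (B g)" if "m \<in> MC0" "g \<in> D" for m g
  proof -
    have "poslin m" using that(1) by (simp add: MC0_def MC_iff)
    then show ?thesis
      by (rule poslin_nonneg[OF poslin_compose[OF _ B] DC[OF that(2)] D0[OF that(2)]])
  qed
  have a0: "0 \<le> a g" if "g \<in> D" for g unfolding a_def by (rule nonneg[OF m0 that])
  have a\<eta>: "0 < a g + \<eta>" if "g \<in> D" for g using a0[OF that] \<eta> by simp
  have Fm0: "F m0 = (\<Sum>g\<in>?D. \<mu> g * ln ((a g + \<eta>) / \<mu> g))"
    unfolding F_def using a0 by (intro sum.cong refl) (simp add: a_def max_def)
  have tangent: "(\<Sum>g\<in>?D. \<mu> g / (a g + \<eta>) * B g x) \<le> 1" for x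
  proof -
    \<comment> \<open>The maximum is tested along the segment from \<open>m0\<close> to evaluation
      at \<open>x\<close>.\<close>
    define m1 where "m1 = vanish_off_CX (\<lambda>f :: 'a \<Rightarrow> real. f x)"
    have m1: "m1 \<in> MC0" unfolding m1_def by (rule vanish_off_CX_in_MC0[OF eval_in_MC])
    have m1B: "m1 (B g) = B g x" if "g \<in> D" for g
      unfolding m1_def by (rule vanish_off_CX_apply[OF positive_linear_op_CX[OF B DC[OF that]]])
    have Bg0: "0 \<le> B g x" if "g \<in> D" for g using nonneg[OF m1 that] m1B[OF that] by simp
    define h where "h t = (\<Sum>g\<in>?D. \<mu> g * ln ((a g + t * (B g x - a g) + \<eta>) / \<mu> g))" for t
    define h' where "h' = (\<Sum>g\<in>?D. \<mu> g * ((B g x - a g) / (a g + \<eta>)))"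
    have "(h has_real_derivative h') (at 0)"
      unfolding h_def[abs_def] h'_def
    proof (rule DERIV_sum)
      fix g assume g: "g \<in> ?D"
      have q: "0 < a g + \<eta>" "0 < \<mu> g" using a\<eta> \<mu>p g by auto
      then have p: "0 < (a g + 0 * (B g x - a g) + \<eta>) / \<mu> g" by simp
      have "((\<lambda>t. (a g + t * (B g x - a g) + \<eta>) / \<mu> g) has_real_derivative (B g x - a g) / \<mu> g) (at 0)"
        using g by (auto intro!: derivative_eq_intros)
      from DERIV_cmult[OF DERIV_chain2[OF DERIV_ln[OF p] this], of "\<mu> g"]
      show "((\<lambda>t. \<mu> g * ln ((a g + t * (B g x - a g) + \<eta>) / \<mu> g)) has_real_derivative
          \<mu> g * ((B g x - a g) / (a g + \<eta>))) (at 0)"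
        by (rule DERIV_cong) (use q in simp)
    qed
    moreover have "h t \<le> h 0" if t: "0 \<le> t" "t \<le> 1" for t
    proof -
      let ?m = "\<lambda>f. (1 - t) * m0 f + t * m1 f"
      have m: "?m \<in> MC0" by (rule MC0_convex[OF m0 m1 t])
      have "h t = F ?m"
        unfolding h_def F_def
      proof (intro sum.cong refl)
        fix g assume "g \<in> ?D"
        then have g: "g \<in> D" by simp
        have "a g + t * (B g x - a g) = ?m (B g)"
          using m1B[OF g] by (simp add: a_def algebra_simps)
        moreover have "max 0 (?m (B g)) = ?m (B g)" using nonneg[OF m g] by (simp add: max_def)
        ultimately show "\<mu> g * ln ((a g + t * (B g x - a g) + \<eta>) / \<mu> g)
          = \<mu> g * ln ((max 0 (?m (B g)) + \<eta>) / \<mu> g)" by simp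
      qed
      also have "\<dots> \<le> F m0" by (rule max[OF m])
      also have "\<dots> = h 0" by (simp add: Fm0 h_def)
      finally show ?thesis .
    qed
    ultimately have "h' \<le> 0"
    proof (rule_tac ccontr)
      assume der: "(h has_real_derivative h') (at 0)" and le: "\<And>t. 0 \<le> t \<Longrightarrow> t \<le> 1 \<Longrightarrow> h t \<le> h 0"
        and "\<not> h' \<le> 0"
      then obtain d where d: "d > 0" "\<forall>t>0. t < d \<longrightarrow> h 0 < h (0 + t)"
        using DERIV_pos_inc_right[OF der] by auto
      have "h 0 < h (min 1 (d / 2))" using d by (auto simp: min_def)
      moreover have "h (min 1 (d / 2)) \<le> h 0" using d(1) by (intro le) auto
      ultimately show False by simp
    qed
    \<comment> \<open>In \<open>h'\<close> the subtracted terms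
      \<open>\<mu> g * a g / (a g + \<eta>)\<close> are at most \<open>\<mu> g\<close>, and these
      sum to 1.\<close>
    moreover have "(\<Sum>g\<in>?D. \<mu> g / (a g + \<eta>) * B g x) - 1 \<le> h'"
    proof -
      have "(\<Sum>g\<in>?D. \<mu> g / (a g + \<eta>) * B g x - \<mu> g) \<le> h'"
        unfolding h'_def
      proof (rule sum_mono)
        fix g assume g: "g \<in> ?D"
        have "\<mu> g / (a g + \<eta>) * B g x - \<mu> g = \<mu> g * ((B g x - a g) / (a g + \<eta>)) - \<mu> g * (\<eta> / (a g + \<eta>))"
        proof -
          have "a g / (a g + \<eta>) + \<eta> / (a g + \<eta>) = 1"
            using a\<eta>[of g] g by (simp add: add_divide_distrib[symmetric])
          then have "\<mu> g * (a g / (a g + \<eta>)) + \<mu> g * (\<eta> / (a g + \<eta>)) = \<mu> g"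
            by (metis distrib_left mult.right_neutral)
          then show ?thesis by (simp add: diff_divide_distrib right_diff_distrib)
        qed
        moreover have "0 \<le> \<mu> g * (\<eta> / (a g + \<eta>))"
          using \<mu>0[of g] a\<eta>[of g] \<eta> g by simp
        ultimately show "\<mu> g / (a g + \<eta>) * B g x - \<mu> g \<le> \<mu> g * ((B g x - a g) / (a g + \<eta>))" by linarith
      qed
      then show ?thesis using sum1 by (simp add: sum_subtractf)
    qed
    ultimately show ?thesis by linarith
  qed
  \<comment> \<open>The extra \<open>\<eta>\<close> keeps \<open>w\<close> positive even where only
    members with \<open>\<mu> g = 0\<close> live, so that \<open>ln w\<close> is continuous; it
    costs \<open>\<eta> * b\<close> in \<open>Bw\<close>.\<close>
  define v where "v g = \<mu> g / (a g + \<eta>) + \<eta>" for g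
  define w where "w x = (\<Sum>g\<in>D. v g * g x)" for x
  define \<psi> where "\<psi> x = (1 / real n) * ln (w x)" for x
  have v\<eta>: "\<eta> \<le> v g" if "g \<in> D" for g
    using \<mu>0[OF that] a\<eta>[OF that] by (simp add: v_def)
  have vp: "0 < v g" if "g \<in> D" for g using v\<eta>[OF that] \<eta> by simp
  have wp: "0 < w x" for x
  proof -
    have "\<eta> = (\<Sum>g\<in>D. \<eta> * g x)" using D1 by (simp add: sum_distrib_left[symmetric])
    also have "\<dots> \<le> w x" unfolding w_def by (intro sum_mono mult_right_mono v\<eta> D0)
    finally show ?thesis using \<eta> by simp
  qed
  have wC: "w \<in> CX" unfolding w_def[abs_def] by (intro CX_sum CX_mult CX_const DC)
  have lnw: "(\<lambda>x. ln (w x)) \<in> CX" by (rule CX_ln[OF wC wp])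
  have \<psi>C: "\<psi> \<in> CX" unfolding \<psi>_def[abs_def] by (intro CX_mult CX_const lnw)
  have exp\<psi>: "exp (real n * \<psi> x) = w x" for x
    using n wp[of x] by (simp add: \<psi>_def)
  have Bw: "B w x \<le> 1 + \<eta> * b" for x
  proof -
    note Bpl = positive_linear_op_poslin[OF B, of x]
    have "B w x = (\<Sum>g\<in>D. B (\<lambda>x. v g * g x) x)"
      unfolding w_def[abs_def] by (rule poslin_sum[OF Bpl fin]) (intro CX_mult CX_const DC)
    also have "\<dots> = (\<Sum>g\<in>D. v g * B g x)"
      by (intro sum.cong refl poslin_scale[OF Bpl] DC)
    also have "\<dots> = (\<Sum>g\<in>D. \<mu> g / (a g + \<eta>) * B g x) + \<eta> * (\<Sum>g\<in>D. B g x)"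
      by (simp add: v_def distrib_right sum.distrib sum_distrib_left)
    also have "(\<Sum>g\<in>D. \<mu> g / (a g + \<eta>) * B g x) = (\<Sum>g\<in>?D. \<mu> g / (a g + \<eta>) * B g x)"
      using fin by (intro sum.mono_neutral_right) auto
    also have "(\<Sum>g\<in>D. B g x) = B \<one> x"
      using partition_poslin_sum[OF D Bpl CX_one] by (simp add: one_fun_apply)
    also have "(\<Sum>g\<in>?D. \<mu> g / (a g + \<eta>) * B g x) + \<eta> * B \<one> x \<le> 1 + \<eta> * b"
      using \<eta> unfolding b_def
      by (intro add_mono tangent mult_left_mono positive_linear_op_one_le_supnorm[OF comp B]) simp
    finally show ?thesis .
  qed
  have C: "0 < 1 + \<eta> * b" using \<eta> b0 by (simp add: add_pos_nonneg)
  have "spec_lambda A \<psi> \<le> ereal (ln (1 + \<eta> * b) / real n)"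
  proof (rule spec_lambda_le_ln_divide[OF comp cont tr \<psi>C n C])
    show "(A ^^ n) (\<lambda>x. exp (real n * \<psi> x)) x \<le> 1 + \<eta> * b" for x
      using Bw[of x] unfolding exp\<psi> B_def by (simp add: eta_contract_eq)
  qed
  then have "ereal (S + \<mu> \<psi>) \<le> ereal (ln (1 + \<eta> * b) / real n)"
    by (rule order_trans[OF S[OF \<psi>C]])
  then have upper: "real n * S + real n * \<mu> \<psi> \<le> ln (1 + \<eta> * b)"
    using n by (simp add: field_simps)
  \<comment> \<open>Concavity of the logarithm on the convex combination \<open>w x\<close> with
    weights \<open>g x\<close>, integrated by \<open>\<mu>\<close>.\<close>
  have "- F m0 \<le> real n * \<mu> \<psi>"
  proof -
    have "- F m0 \<le> (\<Sum>g\<in>?D. \<mu> g * ln (v g))"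
      unfolding Fm0 sum_negf[symmetric]
    proof (rule sum_mono)
      fix g assume g: "g \<in> ?D"
      have p: "0 < a g + \<eta>" "0 < \<mu> g" using a\<eta> \<mu>p g by auto
      have "- ln ((a g + \<eta>) / \<mu> g) = ln (\<mu> g / (a g + \<eta>))" using p by (simp add: ln_div)
      also have "\<dots> \<le> ln (v g)" using p \<eta> unfolding v_def by (intro ln_mono) simp_all
      finally show "- (\<mu> g * ln ((a g + \<eta>) / \<mu> g)) \<le> \<mu> g * ln (v g)"
        using p(2) by (metis mult_left_mono mult_minus_right less_imp_le)
    qed
    also have "\<dots> = (\<Sum>g\<in>D. ln (v g) * \<mu> g)"
      using fin by (subst sum.mono_neutral_right[of D ?D]) (auto simp: mult.commute)
    also have "\<dots> = (\<Sum>g\<in>D. \<mu> (\<lambda>x. ln (v g) * g x))"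
      by (intro sum.cong refl poslin_scale[OF \<mu>pl, symmetric] DC)
    also have "\<dots> = \<mu> (\<lambda>x. \<Sum>g\<in>D. ln (v g) * g x)"
      by (rule poslin_sum[OF \<mu>pl fin, symmetric]) (intro CX_mult CX_const DC)
    also have "\<dots> \<le> \<mu> (\<lambda>x. ln (w x))"
    proof (rule poslin_mono[OF \<mu>pl _ lnw])
      show "(\<lambda>x. \<Sum>g\<in>D. ln (v g) * g x) \<in> CX" by (intro CX_sum CX_mult CX_const DC)
      fix x
      have "exp (\<Sum>g\<in>D. g x * ln (v g)) \<le> (\<Sum>g\<in>D. g x * exp (ln (v g)))"
        by (rule exp_weighted_sum_le[OF fin D1 D0])
      also have "\<dots> = w x" unfolding w_def using vp by (intro sum.cong refl) (simp add: mult.commute)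
      finally show "(\<Sum>g\<in>D. ln (v g) * g x) \<le> ln (w x)"
        using wp[of x] by (simp add: ln_ge_iff mult.commute)
    qed
    also have "\<dots> = real n * \<mu> \<psi>"
      unfolding \<psi>_def[abs_def] poslin_scale[OF \<mu>pl lnw] using n by simp
    finally show ?thesis .
  qed
  with upper have "real n * S \<le> F m0 + ln (1 + \<eta> * b)" by linarith
  then show ?thesis using m0 unfolding F_def b_def B_def by blast
qed

text \<open>Removes the regularisation: compactness yields one \<open>m\<close> that satisfies the
  bound for every \<open>\<eta>\<close>, and then \<open>\<eta>\<close> tends to 0. In the
  application \<open>S\<close> is \<open>l - \<mu> \<phi>\<close>.\<close>

lemma tau_nD_ge:
  fixes A :: "('a::topological_space \<Rightarrow> real) \<Rightarrow> ('a \<Rightarrow> real)"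
  assumes comp: "compact (UNIV :: 'a set)" and cont: "continuous_on UNIV \<alpha>"
    and tr: "transfer_operator \<alpha> A" and \<mu>: "\<mu> \<in> MC" and n: "0 < n"
    and D: "D \<in> partitions_of_unity"
    and S: "\<And>\<psi>. \<psi> \<in> CX \<Longrightarrow> ereal (S + \<mu> \<psi>) \<le> spec_lambda A \<psi>"
  shows "ereal (real n * S) \<le> tau_nD A n \<mu> D"
proof -
  define B where "B = A ^^ n"
  define b where "b = supnorm (B \<one>)"
  have pos: "positive_linear_op A" using tr unfolding transfer_operator_def by blast
  have B: "positive_linear_op B" unfolding B_def by (rule positive_linear_op_funpow[OF pos])
  have b0: "0 \<le> b" unfolding b_def by (rule supnorm_one_nonneg[OF comp B])
  have \<mu>pl: "poslin \<mu>" using \<mu> by (simp add: MC_iff)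
  have fin: "finite D" and DC: "\<And>g. g \<in> D \<Longrightarrow> g \<in> CX" and D0: "\<And>g x. g \<in> D \<Longrightarrow> 0 \<le> g x"
    using D by (auto simp: partitions_of_unity_def)
  let ?D = "{g \<in> D. \<mu> g \<noteq> 0}"
  have \<mu>p: "0 < \<mu> g" if "g \<in> ?D" for g
    using poslin_nonneg[of \<mu> g] \<mu>pl DC[of g] D0[of g] that by fastforce
  define F where "F \<eta> m = (\<Sum>g\<in>?D. \<mu> g * ln ((max 0 (m (B g)) + \<eta>) / \<mu> g)) + ln (1 + \<eta> * b)"
    for \<eta> and m :: "('a \<Rightarrow> real) \<Rightarrow> real"
  have ex: "\<exists>m\<in>MC0. real n * S \<le> F \<eta> m" if "0 < \<eta>" for \<eta>
    unfolding F_def b_def B_def by (rule regularised_entropy_bound[OF comp cont tr \<mu> n D that S])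
  have mono: "F \<eta> m \<le> F \<eta>' m" if "0 < \<eta>" "\<eta> \<le> \<eta>'" for \<eta> \<eta>' m
    unfolding F_def
  proof (intro add_mono sum_mono mult_left_mono)
    fix g assume g: "g \<in> ?D"
    have "0 < (max 0 (m (B g)) + \<eta>) / \<mu> g" using \<mu>p[OF g] that(1) by (simp add: add_nonneg_pos)
    moreover have "(max 0 (m (B g)) + \<eta>) / \<mu> g \<le> (max 0 (m (B g)) + \<eta>') / \<mu> g"
      using \<mu>p[OF g] that by (intro divide_right_mono) auto
    ultimately show "ln ((max 0 (m (B g)) + \<eta>) / \<mu> g) \<le> ln ((max 0 (m (B g)) + \<eta>') / \<mu> g)"
      by simp
    show "0 \<le> \<mu> g" using \<mu>p[OF g] by simp
  next
    show "ln (1 + \<eta> * b) \<le> ln (1 + \<eta>' * b)"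
      using that b0 by (simp add: add_pos_nonneg mult_right_mono)
  qed
  \<comment> \<open>The closed sets decrease together with \<open>\<eta>\<close>, so any finitely
    many of them contain a nonempty one of smallest index.\<close>
  have "MC0 \<inter> (\<Inter>\<eta>\<in>{0<..}. {m. real n * S \<le> F \<eta> m}) \<noteq> {}"
  proof (rule compact_imp_fip_image[OF compact_MC0[OF comp]])
    fix \<eta> :: real assume \<eta>: "\<eta> \<in> {0<..}"
    show "closed {m. real n * S \<le> F \<eta> m}"
      unfolding F_def
    proof (intro closed_Collect_le continuous_on_sum continuous_on_mult continuous_on_const continuous_on_ln
        continuous_on_divide continuous_on_add continuous_on_max continuous_on_product_coordinates ballI)
      fix g and m :: "('a \<Rightarrow> real) \<Rightarrow> real" assume g: "g \<in> ?D"
      show "\<mu> g \<noteq> 0" using g by simp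
      have "0 < max 0 (m (B g)) + \<eta>" using \<eta> by (simp add: add_nonneg_pos)
      then show "(max 0 (m (B g)) + \<eta>) / \<mu> g \<noteq> 0" using g by simp
    qed
  next
    fix I :: "real set" assume I: "finite I" "I \<subseteq> {0<..}"
    define \<eta> where "\<eta> = Min (insert 1 I)"
    have "0 < \<eta>" unfolding \<eta>_def using I by (subst Min_gr_iff) auto
    moreover have "\<eta> \<le> i" if "i \<in> I" for i unfolding \<eta>_def using I that by simp
    moreover obtain m where "m \<in> MC0" "real n * S \<le> F \<eta> m" using ex[OF \<open>0 < \<eta>\<close>] by blast
    ultimately have "m \<in> MC0 \<inter> (\<Inter>\<eta>\<in>I. {m. real n * S \<le> F \<eta> m})"
      using mono[of \<eta> _ m] by (auto intro: order_trans)
    then show "MC0 \<inter> (\<Inter>\<eta>\<in>I. {m. real n * S \<le> F \<eta> m}) \<noteq> {}" by blast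
  qed
  then obtain m where m: "m \<in> MC0" and mF: "\<And>\<eta>. 0 < \<eta> \<Longrightarrow> real n * S \<le> F \<eta> m" by auto
  have mMC: "m \<in> MC" using m by (simp add: MC0_def)
  define a where "a g = m (B g)" for g
  have a0: "0 \<le> a g" if "g \<in> D" for g
    unfolding a_def
    using mMC that by (intro poslin_nonneg[OF poslin_compose[OF _ B] DC D0]) (auto simp: MC_iff)
  have Fa: "F \<eta> m = (\<Sum>g\<in>?D. \<mu> g * ln ((a g + \<eta>) / \<mu> g)) + ln (1 + \<eta> * b)" for \<eta>
    unfolding F_def using a0 by (intro arg_cong2[where f = "(+)"] sum.cong refl) (simp add: a_def max_def)
  \<comment> \<open>If \<open>a h\<close> were 0, the summand of \<open>h\<close> would tend to
    \<open>-\<infinity>\<close> as \<open>\<eta>\<close> tends to 0, against a lower bound uniform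
    in \<open>\<eta>\<close>.\<close>
  have ap: "0 < a h" if h: "h \<in> ?D" for h
  proof (rule ccontr)
    assume "\<not> 0 < a h"
    then have ah: "a h = 0" using a0[of h] h by simp
    define K where "K = (\<Sum>g\<in>?D - {h}. \<mu> g * ln ((a g + 1) / \<mu> g)) + ln (1 + b)"
    \<comment> \<open>\<open>K\<close> bounds all other terms for \<open>\<eta> \<le> 1\<close>; the
      second entry of \<open>min\<close> brings the summand of \<open>h\<close> down to
      \<open>real n * S - K - 1\<close>.\<close>
    define \<eta> where "\<eta> = min 1 (\<mu> h * exp ((real n * S - K - 1) / \<mu> h))"
    have \<eta>: "0 < \<eta>" "\<eta> \<le> 1" using \<mu>p[OF h] by (auto simp: \<eta>_def)
    have "F \<eta> m = \<mu> h * ln (\<eta> / \<mu> h) + (\<Sum>g\<in>?D - {h}. \<mu> g * ln ((a g + \<eta>) / \<mu> g)) + ln (1 + \<eta> * b)"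
      unfolding Fa using fin h ah by (subst sum.remove[of _ h]) auto
    also have "\<dots> \<le> \<mu> h * ln (\<eta> / \<mu> h) + K"
    proof -
      have "(\<Sum>g\<in>?D - {h}. \<mu> g * ln ((a g + \<eta>) / \<mu> g)) \<le> (\<Sum>g\<in>?D - {h}. \<mu> g * ln ((a g + 1) / \<mu> g))"
      proof (intro sum_mono mult_left_mono)
        fix g assume "g \<in> ?D - {h}"
        then have g: "0 < \<mu> g" "0 \<le> a g" using \<mu>p a0 by auto
        have "0 < (a g + \<eta>) / \<mu> g" using g \<eta> by (simp add: add_nonneg_pos)
        moreover have "(a g + \<eta>) / \<mu> g \<le> (a g + 1) / \<mu> g" using g \<eta> by (intro divide_right_mono) auto
        ultimately show "ln ((a g + \<eta>) / \<mu> g) \<le> ln ((a g + 1) / \<mu> g)" by simp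
        show "0 \<le> \<mu> g" using g by simp
      qed
      moreover have "ln (1 + \<eta> * b) \<le> ln (1 + b)"
        using \<eta> b0 by (simp add: add_pos_nonneg mult_left_le_one_le)
      ultimately show ?thesis by (simp add: K_def)
    qed
    also have "\<mu> h * ln (\<eta> / \<mu> h) \<le> real n * S - K - 1"
    proof -
      have "\<eta> / \<mu> h \<le> exp ((real n * S - K - 1) / \<mu> h)"
        using \<mu>p[OF h] by (simp add: \<eta>_def pos_divide_le_eq mult.commute)
      then have "ln (\<eta> / \<mu> h) \<le> (real n * S - K - 1) / \<mu> h"
        using \<eta>(1) \<mu>p[OF h] by (metis divide_pos_pos exp_gt_zero ln_exp ln_le_cancel_iff)
      then show ?thesis using \<mu>p[OF h] by (simp add: pos_le_divide_eq mult.commute)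
    qed
    finally show False using mF[OF \<eta>(1)] by simp
  qed
  have "((\<lambda>\<eta>. F \<eta> m) \<longlongrightarrow> (\<Sum>g\<in>?D. \<mu> g * ln ((a g + 0) / \<mu> g)) + ln (1 + 0 * b)) (at_right 0)"
    unfolding Fa
  proof (intro tendsto_add tendsto_sum tendsto_mult tendsto_const tendsto_ln tendsto_divide tendsto_ident_at)
    fix g assume g: "g \<in> ?D"
    show "\<mu> g \<noteq> 0" "(a g + 0) / \<mu> g \<noteq> 0" using g ap[OF g] by auto
  qed simp
  then have "real n * S \<le> (\<Sum>g\<in>?D. \<mu> g * ln ((a g + 0) / \<mu> g)) + ln (1 + 0 * b)"
    by (rule tendsto_lowerbound) (auto intro!: eventually_at_rightI[of 0 1] mF)
  then have "real n * S \<le> (\<Sum>g\<in>?D. \<mu> g * ln (a g / \<mu> g))" by simp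
  then have "ereal (real n * S) \<le> (\<Sum>g\<in>?D. ereal (\<mu> g * ln (a g / \<mu> g)))" by simp
  also have "\<dots> = (\<Sum>g\<in>?D. ereal (\<mu> g) * eln (m (B g) / \<mu> g))"
    using ap \<mu>p by (intro sum.cong refl) (simp add: eln_def a_def)
  also have "\<dots> \<le> tau_nD A n \<mu> D"
    unfolding tau_nD_def B_def by (rule SUP_upper[OF mMC])
  finally show ?thesis .
qed

theorem theorem1p17:
  fixes \<alpha> :: "'a::t2_space \<Rightarrow> 'a"
    and A :: "('a \<Rightarrow> real) \<Rightarrow> ('a \<Rightarrow> real)"
    and \<phi> :: "'a \<Rightarrow> real"
  assumes "compact (UNIV :: 'a set)"
    and "continuous_on UNIV \<alpha>"
    and "transfer_operator \<alpha> A"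
    and "\<phi> \<in> CX"
  shows "\<exists>\<mu>\<in>Mdelta \<alpha>. t_entropy A \<mu> + ereal (\<mu> \<phi>) = spec_lambda A \<phi> \<and>
           (\<forall>\<nu>\<in>Mdelta \<alpha>. t_entropy A \<nu> + ereal (\<nu> \<phi>) \<le> spec_lambda A \<phi>)"
proof -
  have pos: "positive_linear_op A" using assms(3) unfolding transfer_operator_def by blast
  note upper = t_entropy_le_spec_lambda[OF assms]
  have "\<exists>\<mu>\<in>Mdelta \<alpha>. spec_lambda A \<phi> \<le> t_entropy A \<mu> + ereal (\<mu> \<phi>)"
  \<comment> \<open>A real value calls for the tangent functional; \<open>\<infinity>\<close> is
    excluded by the term with \<open>n = 1\<close>, and for \<open>-\<infinity>\<close> any
    invariant functional works.\<close>
  proof (cases "spec_lambda A \<phi>")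
    case (real l)
    from spec_lambda_tangent[OF assms real] obtain \<mu> where \<mu>: "\<mu> \<in> Mdelta \<alpha>"
      and tan: "\<And>\<psi>. \<psi> \<in> CX \<Longrightarrow> ereal (l + (\<mu> \<psi> - \<mu> \<phi>)) \<le> spec_lambda A \<psi>" by blast
    have "ereal (l - \<mu> \<phi>) \<le> t_entropy A \<mu>"
      unfolding t_entropy_def
    proof (rule INF_greatest)
      fix n :: nat assume "n \<in> {1..}"
      then have n: "0 < n" by simp
      have \<mu>M: "\<mu> \<in> MC" using \<mu> by (simp add: Mdelta_def)
      have "ereal (real n * (l - \<mu> \<phi>)) \<le> tau_n A n \<mu>"
        unfolding tau_n_def
      proof (rule INF_greatest)
        fix D :: "('a \<Rightarrow> real) set" assume D: "D \<in> partitions_of_unity"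
        show "ereal (real n * (l - \<mu> \<phi>)) \<le> tau_nD A n \<mu> D"
        proof (rule tau_nD_ge[OF assms(1-3) \<mu>M n D])
          show "ereal (l - \<mu> \<phi> + \<mu> \<psi>) \<le> spec_lambda A \<psi>" if "\<psi> \<in> CX" for \<psi>
            using tan[OF that] by (simp add: algebra_simps)
        qed
      qed
      then have "ereal (real n * (l - \<mu> \<phi>)) / ereal (real n) \<le> tau_n A n \<mu> / ereal (real n)"
        using n by (intro ereal_divide_right_mono) auto
      then show "ereal (l - \<mu> \<phi>) \<le> tau_n A n \<mu> / ereal (real n)" using n by simp
    qed
    then have "ereal (l - \<mu> \<phi>) + ereal (\<mu> \<phi>) \<le> t_entropy A \<mu> + ereal (\<mu> \<phi>)"
      by (rule add_right_mono)
    then show ?thesis using \<mu> real by auto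
  next
    case PInf
    have "spec_lambda A \<phi> \<le> eln (supnorm ((Aphi A \<phi> ^^ 1) \<one>)) / ereal (real 1)"
      unfolding spec_lambda_eq_INF[OF assms(1) pos assms(4)] by (rule INF_lower) simp
    then show ?thesis using PInf by (simp add: eln_def divide_ereal_def split: if_splits)
  next
    case MInf
    \<comment> \<open>\<open>undefined\<close> serves as an arbitrary point; the averages along its
      orbit cluster at an invariant functional.\<close>
    obtain \<mu> where "\<mu> \<in> Mdelta \<alpha>"
      by (rule Mdelta_cluster_point[OF assms(1,2), of "\<lambda>_ f. f undefined"]) (rule eval_in_MC)
    then show ?thesis using MInf by auto
  qed
  then show ?thesis using upper by (metis antisym)
qed

end
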